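(* Let $S_n=S_n(p)$ be the number of complete stable matchings in the random model with $n$ men, $n$ women, independent uniformly random complete preference lists, and independent admissibility of each pair with probability $p=p(n)\in(0,1)$. Then, as $n\to\infty$: (i) if, for some constant $\alpha>2$, $p(n)\le \frac{\log^2 n}{n}\bigl(1-\alpha\frac{\log\log n}{\log n}\bigr)$, then $\mathbb{E}[S_n]\to 0$; (ii) if $p(n)\ge \frac{\log^2 n}{n}$, then $\mathbb{E}[S_n]\to\infty$.
   Context: Model. There are $n$ men and $n$ women. Each man has a preference list which is a permutation (strict linear order) of all $n$ women, and each woman has a preference list which is a permutation of all $n$ men; the $2n$ lists are independent and uniformly random. Independently of the lists, each of the $n^2$ pairs (man, woman) is admissible with probability $p=p(n)$, independently of all other pairs. A complete matching is a bijection $M$ between the men and the women. It is called stable if (a) every pair matched by $M$ is admissible, and (b) there is no admissible pair $(m,w)$, not matched to each other in $M$, such that $m$ prefers $w$ to his partner in $M$ and $w$ prefers $m$ to her partner in $M$. $S_n$ is the number of complete stable matchings. Inequalities on $p(n)$ are understood to hold for all sufficiently large $n$; $\log$ is the natural logarithm. *)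

theory Defs
  imports "HOL-Probability.Probability" "HOL-Combinatorics.Combinatorics"
begin

text \<open>Men and women are both labelled by \<open>{..<n}\<close>; preference lists run from best to worst.\<close>

type_synonym prefs = "nat \<Rightarrow> nat list"

definition prefers :: "nat list \<Rightarrow> nat \<Rightarrow> nat \<Rightarrow> bool" where
  "prefers xs a b \<longleftrightarrow> (\<exists>i j. i < j \<and> j < length xs \<and> xs ! i = a \<and> xs ! j = b)"

text \<open>
  A complete matching is a map \<open>M\<close> sending each man to his wife. The condition
  \<open>M permutes {..<n}\<close> says that \<open>M\<close> is a bijection from the men to the women and is the
  identity outside \<open>{..<n}\<close>, so that every bijection is counted exactly once; \<open>inv M w\<close> is
  the husband of \<open>w\<close>. A pair \<open>(m, w)\<close> is always given with the man first.
\<close>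

definition stable_complete_matching ::
  "nat \<Rightarrow> prefs \<Rightarrow> prefs \<Rightarrow> (nat \<times> nat \<Rightarrow> bool) \<Rightarrow> (nat \<Rightarrow> nat) \<Rightarrow> bool" where
  "stable_complete_matching n mpref wpref adm M \<longleftrightarrow>
     M permutes {..<n} \<and>
     (\<forall>m<n. adm (m, M m)) \<and>
     \<not> (\<exists>m<n. \<exists>w<n. adm (m, w) \<and> M m \<noteq> w \<and>
           prefers (mpref m) w (M m) \<and> prefers (wpref w) m (inv M w))"

definition num_stable :: "nat \<Rightarrow> prefs \<times> prefs \<times> (nat \<times> nat \<Rightarrow> bool) \<Rightarrow> nat" where
  "num_stable n = (\<lambda>(mpref, wpref, adm).
     card {M. stable_complete_matching n mpref wpref adm M})"

text \<open>The values \<open>[]\<close> and \<open>False\<close> are dummies taken outside the index sets.\<close>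

definition random_prefs :: "nat \<Rightarrow> prefs pmf" where
  "random_prefs n = Pi_pmf {..<n} [] (\<lambda>_. pmf_of_set (permutations_of_set {..<n}))"

definition random_admissible :: "nat \<Rightarrow> real \<Rightarrow> (nat \<times> nat \<Rightarrow> bool) pmf" where
  "random_admissible n p = Pi_pmf ({..<n} \<times> {..<n}) False (\<lambda>_. bernoulli_pmf p)"

definition matching_model :: "nat \<Rightarrow> real \<Rightarrow> (prefs \<times> prefs \<times> (nat \<times> nat \<Rightarrow> bool)) pmf" where
  "matching_model n p =
     pair_pmf (random_prefs n) (pair_pmf (random_prefs n) (random_admissible n p))"

definition expected_stable :: "nat \<Rightarrow> real \<Rightarrow> real" where
  "expected_stable n p =
     measure_pmf.expectation (matching_model n p) (\<lambda>\<omega>. real (num_stable n \<omega>))"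

end

theory Submission
  imports Defs "HOL-Real_Asymp.Real_Asymp"
begin

text \<open>
  Fix a matching \<open>M\<close> and let \<open>d\<^sub>w\<close> be the number of men who prefer \<open>w\<close> to their partner. Among these
  men and her husband the husband has uniform rank in the list of \<open>w\<close>, so, averaging over admissibility
  and the women's lists, \<open>M\<close> is stable with conditional probability \<open>\<Prod>\<^sub>w f(d\<^sub>w)\<close>, where
  \<open>f(d) = (1 - (1 - p)^(d + 1)) / (d + 1)\<close>. Moreover \<open>R = \<Sum>\<^sub>w (d\<^sub>w + 1)\<close> is the sum of the
  ranks of the wives, and these \<open>n\<close> ranks are independent and uniform on \<open>{1..n}\<close>.

  Lower bound: \<open>f\<close> is log-convex in \<open>d + 1\<close>, so the product is at least \<open>((n/R) (1 - e^(-pR/n)))^n\<close>, and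
  it suffices to count the rank vectors with sum \<open>R\<close> for \<open>n\<^sup>2/R\<close> between \<open>ln n + 2\<close> and \<open>ln n + 3\<close>.

  Upper bound: \<open>f(d) = p \<integral> (1 - p y)^d dy\<close> over \<open>[0,1]\<close> turns the product over women into one over
  men, and sampling without replacement is dominated by the exponential of the mean. For a given \<open>R\<close>
  this yields roughly \<open>((n/R) (1 - e^(-pR/n)))^n\<close> again, while a Chernoff bound shows that there are
  at most \<open>((e R/n) (1 - e^(-n\<^sup>2/R)))^n\<close> rank vectors with sum \<open>R\<close>. The two exponents \<open>p R/n\<close> and
  \<open>n\<^sup>2/R\<close> have product \<open>p n\<close>, so one of them is at most \<open>sqrt (p n)\<close>, which under the hypothesis
  of (i) is at most \<open>ln n - (\<alpha>/2) ln (ln n)\<close>; this gives the factor \<open>exp (- (ln n)^(\<alpha>/2))\<close> with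
  \<open>\<alpha>/2 > 1\<close>.
\<close>

section \<open>Preference lists and the set of better partners\<close>

text \<open>For an entry \<open>h\<close> of a repetition-free list, the rank of \<open>h\<close> is
  one more than the size of this set.\<close>

definition before :: "nat list \<Rightarrow> nat \<Rightarrow> nat set" where
  "before xs h = {w. prefers xs w h}"

lemma before_append_Cons:
  assumes "distinct (ys @ h # zs)"
  shows "before (ys @ h # zs) h = set ys"
proof -
  have idx: "j = length ys"
    if "j < length (ys @ h # zs)" "(ys @ h # zs) ! j = h" for j
    using that assms nth_eq_iff_index_eq[OF assms, of j "length ys"] by simp
  show ?thesis
    unfolding before_def prefers_def
  proof (intro equalityI subsetI)
    fix w assume "w \<in> {w. \<exists>i j. i < j \<and> j < length (ys @ h # zs) \<and>
                     (ys @ h # zs) ! i = w \<and> (ys @ h # zs) ! j = h}"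
    then obtain i j where ij: "i < j" "j < length (ys @ h # zs)"
      "(ys @ h # zs) ! i = w" "(ys @ h # zs) ! j = h" by auto
    from idx[OF ij(2,4)] ij(1,3) show "w \<in> set ys"
      by (auto simp: nth_append)
  next
    fix w assume "w \<in> set ys"
    then obtain i where "i < length ys" "ys ! i = w" by (auto simp: in_set_conv_nth)
    then show "w \<in> {w. \<exists>i j. i < j \<and> j < length (ys @ h # zs) \<and>
                     (ys @ h # zs) ! i = w \<and> (ys @ h # zs) ! j = h}"
      by (intro CollectI exI[of _ i] exI[of _ "length ys"]) (auto simp: nth_append)
  qed
qed

text \<open>Cutting a list at \<open>h\<close> gives a bijection with triples of a set
  \<open>A\<close>, an arrangement of \<open>A\<close> and an arrangement of the remaining entries.
  The weight of \<open>A\<close> is thus the number of lists in which exactly \<open>A\<close>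
  precedes \<open>h\<close>.\<close>

lemma sum_permutations_of_set_before:
  fixes G :: "nat set \<Rightarrow> real"
  assumes S: "finite S" "h \<in> S"
  shows "(\<Sum>xs\<in>permutations_of_set S. G (before xs h)) =
         (\<Sum>A\<in>Pow (S - {h}). fact (card A) * fact (card S - 1 - card A) * G A)"
proof -
  let ?X = "SIGMA A:Pow (S - {h}). permutations_of_set A \<times> permutations_of_set (S - {h} - A)"
  have before_split: "before (ys @ h # zs) h = A"
    if "A \<subseteq> S - {h}" "ys \<in> permutations_of_set A" "zs \<in> permutations_of_set (S - {h} - A)"
    for A ys zs
  proof -
    have "distinct (ys @ h # zs)" using that by (auto simp: permutations_of_set_def)
    from before_append_Cons[OF this] that(2) show ?thesis by (auto simp: permutations_of_set_def)
  qed
  have "(\<Sum>xs\<in>permutations_of_set S. G (before xs h)) = (\<Sum>(A, ys, zs)\<in>?X. G A)"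
  proof (rule sym, rule sum.reindex_bij_witness
      [of _ "\<lambda>xs. (set (takeWhile (\<lambda>x. x \<noteq> h) xs), takeWhile (\<lambda>x. x \<noteq> h) xs, tl (dropWhile (\<lambda>x. x \<noteq> h) xs))"
       "\<lambda>(A, ys, zs). ys @ h # zs"], goal_cases)
    case (1 t)
    then obtain A ys zs where t: "t = (A, ys, zs)" "A \<subseteq> S - {h}" "ys \<in> permutations_of_set A"
      by auto
    have "takeWhile (\<lambda>x. x \<noteq> h) (ys @ h # zs) = ys" "dropWhile (\<lambda>x. x \<noteq> h) (ys @ h # zs) = h # zs"
      using t by (subst takeWhile_append2 dropWhile_append2; force simp: permutations_of_set_def)+
    with t show ?case by (auto simp: permutations_of_set_def)
  next
    case (2 t)
    then obtain A ys zs where t: "t = (A, ys, zs)" "A \<subseteq> S - {h}" "ys \<in> permutations_of_set A"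
      "zs \<in> permutations_of_set (S - {h} - A)"
      by auto
    then show ?case using S by (auto simp: permutations_of_set_def)
  next
    case (3 xs)
    have "h \<in> set xs" using 3 S by (auto simp: permutations_of_set_def)
    then have "dropWhile (\<lambda>x. x \<noteq> h) xs \<noteq> []" by auto
    then have "dropWhile (\<lambda>x. x \<noteq> h) xs = h # tl (dropWhile (\<lambda>x. x \<noteq> h) xs)"
      by (metis (mono_tags, lifting) hd_dropWhile list.collapse)
    then show ?case
      using takeWhile_dropWhile_id[of "\<lambda>x. x \<noteq> h" xs] by simp
  next
    case (4 xs)
    define ys zs where "ys = takeWhile (\<lambda>x. x \<noteq> h) xs" and "zs = tl (dropWhile (\<lambda>x. x \<noteq> h) xs)"
    have "h \<in> set xs" using 4 S by (auto simp: permutations_of_set_def)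
    then have "dropWhile (\<lambda>x. x \<noteq> h) xs \<noteq> []" by auto
    then have "dropWhile (\<lambda>x. x \<noteq> h) xs = h # zs" unfolding zs_def
      by (metis (mono_tags, lifting) hd_dropWhile list.collapse)
    then have xs: "xs = ys @ h # zs"
      unfolding ys_def using takeWhile_dropWhile_id[of "\<lambda>x. x \<noteq> h" xs] by simp
    have "set xs = S" "distinct xs" using 4 by (auto simp: permutations_of_set_def)
    then have "(set ys, ys, zs) \<in> ?X"
      unfolding xs by (auto simp: permutations_of_set_def)
    then show ?case unfolding ys_def zs_def by simp
  next
    case (5 t)
    then show ?case using before_split by auto
  qed
  also have "\<dots> = (\<Sum>A\<in>Pow (S - {h}). \<Sum>(ys, zs)\<in>permutations_of_set A \<times> permutations_of_set (S - {h} - A). G A)"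
    using S by (subst sum.Sigma) auto
  also have "\<dots> = (\<Sum>A\<in>Pow (S - {h}). fact (card A) * fact (card S - 1 - card A) * G A)"
  proof (rule sum.cong, goal_cases)
    case (2 A)
    then have "finite A" using S by (auto intro: finite_subset)
    moreover have "card (S - {h} - A) = card S - 1 - card A"
      using 2 S \<open>finite A\<close> by (subst card_Diff_subset) auto
    ultimately show ?case using S by (simp add: card_cartesian_product)
  qed simp
  finally show ?thesis .
qed

section \<open>Sums over subsets and sampling without replacement\<close>

lemma fact_choose_real:
  assumes "k \<le> N"
  shows "fact k * fact (N - k) = (fact N :: real) / real (N choose k)"
proof -
  have "fact k * fact (N - k) * (N choose k) = (fact N :: nat)"
    using assms by (rule binomial_fact_lemma)
  then have "real (fact k * fact (N - k) * (N choose k)) = real (fact N)" by simp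
  then show ?thesis using assms by (simp add: field_simps)
qed

lemma sum_Pow_card:
  fixes f :: "'a set \<Rightarrow> real"
  assumes "finite S"
  shows "(\<Sum>A\<in>Pow S. f A) = (\<Sum>k\<le>card S. \<Sum>A | A \<subseteq> S \<and> card A = k. f A)"
proof -
  have "(\<Sum>A\<in>Pow S. f A) = (\<Sum>k\<le>card S. \<Sum>A | A \<in> Pow S \<and> card A = k. f A)"
    using assms by (intro sum.group[symmetric]) (auto intro: card_mono)
  then show ?thesis by simp
qed

lemma sum_Pow_insert:
  fixes f :: "'a set \<Rightarrow> real"
  assumes "finite S" "x \<notin> S"
  shows "(\<Sum>A\<in>Pow (insert x S). f A) = (\<Sum>A\<in>Pow S. f A + f (insert x A))"
proof -
  have "(\<Sum>A\<in>Pow (insert x S). f A) = (\<Sum>A\<in>Pow S. f A) + (\<Sum>A\<in>insert x ` Pow S. f A)"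
    unfolding Pow_insert using assms by (intro sum.union_disjoint) auto
  also have "(\<Sum>A\<in>insert x ` Pow S. f A) = (\<Sum>A\<in>Pow S. f (insert x A))"
  proof (subst sum.reindex)
    show "inj_on (insert x) (Pow S)"
      using assms(2) by (intro inj_onI) (metis PowD insert_ident subsetD)
  qed (simp add: o_def)
  finally show ?thesis by (simp add: sum.distrib)
qed

text \<open>The factorials count the lists of \<open>D\<close>, \<open>T\<close> and one further
  entry \<open>h\<close> in which \<open>A\<close> precedes \<open>h\<close>. Only the order of
  \<open>h\<close> relative to \<open>D\<close> affects the power, so each element of
  \<open>T\<close> merely multiplies the sum by the number of places where it can be inserted. For
  empty \<open>T\<close> every size \<open>k\<close> has total weight
  \<open>fact (card D)\<close>.\<close>

lemma sum_Pow_fact_power_card_Int: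
  fixes q :: real
  assumes "finite T" "finite D" "D \<inter> T = {}"
  shows "(\<Sum>A\<in>Pow (D \<union> T). fact (card A) * fact (card (D \<union> T) - card A) * q ^ card (A \<inter> D)) =
         fact (card (D \<union> T) + 1) / real (card D + 1) * (\<Sum>k\<le>card D. q ^ k)"
  using assms(1,3)
proof (induction T rule: finite_induct)
  case empty
  have "(\<Sum>A\<in>Pow D. fact (card A) * fact (card D - card A) * q ^ card (A \<inter> D)) =
        (\<Sum>k\<le>card D. \<Sum>A | A \<subseteq> D \<and> card A = k. fact k * fact (card D - k) * q ^ k)"
    using assms(2) by (subst sum_Pow_card) (auto intro!: sum.cong simp: Int_absorb2)
  also have "\<dots> = (\<Sum>k\<le>card D. fact (card D) * q ^ k)"
  proof (rule sum.cong, goal_cases)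
    case (2 k)
    have "card {A. A \<subseteq> D \<and> card A = k} = card D choose k"
      using assms(2) by (rule n_subsets)
    then show ?case using 2 by (simp add: fact_choose_real)
  qed simp
  also have "\<dots> = fact (card D + 1) / real (card D + 1) * (\<Sum>k\<le>card D. q ^ k)"
    by (simp add: sum_distrib_left)
  finally show ?case by simp
next
  case (insert x T)
  let ?U = "D \<union> T" and ?c = "card (D \<union> T)"
  have fin: "finite ?U" and x: "x \<notin> ?U" using insert assms by auto
  have "(\<Sum>A\<in>Pow (insert x ?U). fact (card A) * fact (card (insert x ?U) - card A) * q ^ card (A \<inter> D)) =
        (\<Sum>A\<in>Pow ?U. real (?c + 2) * (fact (card A) * fact (?c - card A) * q ^ card (A \<inter> D)))"
    unfolding sum_Pow_insert[OF fin x]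
  proof (rule sum.cong, goal_cases)
    case (2 A)
    then have A: "finite A" "x \<notin> A" "card A \<le> ?c" using fin x by (auto intro: finite_subset card_mono)
    have "insert x A \<inter> D = A \<inter> D" using insert by auto
    moreover have "fact (Suc ?c - card A) = real (Suc ?c - card A) * fact (?c - card A)"
      using A by (simp add: Suc_diff_le)
    moreover have "card (insert x ?U) = Suc ?c" "card (insert x A) = Suc (card A)"
      using A fin x by auto
    ultimately have "fact (card A) * fact (card (insert x ?U) - card A) * q ^ card (A \<inter> D) +
        fact (card (insert x A)) * fact (card (insert x ?U) - card (insert x A)) * q ^ card (insert x A \<inter> D) =
        (real (Suc ?c - card A) + real (Suc (card A))) * (fact (card A) * fact (?c - card A) * q ^ card (A \<inter> D))"
      by (simp add: algebra_simps)
    \<comment> \<open>These are the numbers of places for \<open>x\<close> behind and ahead of the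
      further entry.\<close>
    also have "real (Suc ?c - card A) + real (Suc (card A)) = real (?c + 2)"
      using A by (simp add: of_nat_diff)
    finally show ?case .
  qed simp
  also have "\<dots> = real (?c + 2) * (fact (?c + 1) / real (card D + 1) * (\<Sum>k\<le>card D. q ^ k))"
    unfolding sum_distrib_left[symmetric] using insert by (subst insert.IH) auto
  finally show ?case using fin x by (simp add: field_simps)
qed

text \<open>The left-hand side is convex in \<open>u\<close>, so it suffices to check \<open>u = 0\<close> and \<open>u = w\<close>.\<close>

lemma exp_chord_bound:
  fixes \<theta> u w :: real
  assumes \<theta>: "0 \<le> \<theta>" "\<theta> \<le> 1" and u: "0 \<le> u" "u \<le> w" "w \<le> 1"
  shows "\<theta> * (1 - w) * exp ((1 - \<theta>) * u) + (1 - \<theta>) * exp (- (\<theta> * u)) \<le> exp (- (\<theta> * w))"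
proof -
  let ?g = "\<lambda>u. \<theta> * (1 - w) * exp ((1 - \<theta>) * u) + (1 - \<theta>) * exp (- (\<theta> * u))"
  have "?g u \<le> max (?g 0) (?g w)"
  proof (rule convex_on_le_max[where f = ?g and x = 0 and y = w and a = u])
    show "convex_on {0..w} ?g"
    proof (rule f''_ge0_imp_convex[where
        f' = "\<lambda>x. \<theta> * (1 - w) * (exp ((1 - \<theta>) * x) * (1 - \<theta>)) - (1 - \<theta>) * (exp (- (\<theta> * x)) * \<theta>)" and
        f'' = "\<lambda>x. \<theta> * (1 - w) * (exp ((1 - \<theta>) * x) * (1 - \<theta>)^2) + (1 - \<theta>) * (exp (- (\<theta> * x)) * \<theta>^2)"], goal_cases)
      case 1 show ?case by simp
    next
      case (2 x) show ?case
        by (auto intro!: derivative_eq_intros)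
    next
      case (3 x) show ?case
        by (auto intro!: derivative_eq_intros simp: power2_eq_square algebra_simps)
    next
      case (4 x) show ?case
        using assms by simp
    qed
  qed (use u in auto)
  also have "?g 0 \<le> exp (- (\<theta> * w))"
    using exp_ge_add_one_self[of "- (\<theta> * w)"] by (simp add: algebra_simps)
  also have "?g w \<le> exp (- (\<theta> * w))"
  proof -
    have "(1 - w) * exp w \<le> exp (-w) * exp w"
      using exp_ge_add_one_self[of "- w"] by (intro mult_right_mono) auto
    then have "(1 - w) * exp w \<le> 1" by (simp add: exp_minus_inverse mult.commute)
    then have "\<theta> * ((1 - w) * exp w) + (1 - \<theta>) \<le> \<theta> * 1 + (1 - \<theta>)"
      using \<theta> by (intro add_mono mult_left_mono) auto
    then have "exp (- (\<theta> * w)) * (\<theta> * ((1 - w) * exp w) + (1 - \<theta>)) \<le> exp (- (\<theta> * w)) * 1"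
      by (intro mult_left_mono) auto
    moreover have "exp ((1 - \<theta>) * w) = exp (- (\<theta> * w)) * exp w"
      by (simp add: mult_exp_exp algebra_simps)
    ultimately show ?thesis by (simp add: algebra_simps)
  qed
  finally show ?thesis by simp
qed

text \<open>Induction on \<open>S\<close>, removing an element of largest weight: only then is the mean of the
  remaining weights at most the removed one, as \<open>exp_chord_bound\<close> needs.\<close>

lemma sum_subsets_prod_le:
  fixes w :: "'a \<Rightarrow> real"
  assumes "finite S" "\<And>x. x \<in> S \<Longrightarrow> 0 \<le> w x \<and> w x \<le> 1"
  shows "(\<Sum>A | A \<subseteq> S \<and> card A = k. \<Prod>x\<in>A. 1 - w x) \<le>
         real (card S choose k) * exp (- (real k / real (card S) * (\<Sum>x\<in>S. w x)))"
  using assms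
proof (induction "card S" arbitrary: S k)
  case 0
  then have [simp]: "S = {}" by simp
  have "{A. A \<subseteq> S \<and> card A = k} = (if k = 0 then {{}} else {})" by auto
  then show ?case by (cases "k = 0") (simp_all only: if_True if_False sum.empty, simp_all)
next
  case (Suc N S k)
  have fin: "finite S" and S0: "S \<noteq> {}" and N: "card S = Suc N" using Suc by auto
  obtain j where j: "j \<in> S" "\<And>x. x \<in> S \<Longrightarrow> w x \<le> w j"
  proof -
    have "Max (w ` S) \<in> w ` S" using fin S0 by auto
    then obtain j where "j \<in> S" "w j = Max (w ` S)" by auto
    with fin show ?thesis by (intro that[of j]) auto
  qed
  define T where "T = S - {j}"
  have T: "finite T" "j \<notin> T" "S = insert j T" "card T = N" using fin j N by (auto simp: T_def)
  have wT: "0 \<le> w x \<and> w x \<le> 1" if "x \<in> T" for x using Suc.prems that T by auto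
  have wj: "0 \<le> w j" "w j \<le> 1" using Suc.prems j by auto
  have IH: "(\<Sum>A | A \<subseteq> T \<and> card A = k. \<Prod>x\<in>A. 1 - w x) \<le>
         real (N choose k) * exp (- (real k / real N * (\<Sum>x\<in>T. w x)))" for k
    using Suc.hyps(1)[of T k] T wT by simp
  show ?case
  proof (cases k)
    case 0
    have "{A. A \<subseteq> S \<and> card A = 0} = {{}}"
      using fin by (auto simp: card_eq_0_iff dest: finite_subset)
    then show ?thesis using 0 by simp
  next
    case (Suc k')
    show ?thesis
    proof (cases "k \<le> Suc N")
      case False
      then have empty: "{A. A \<subseteq> S \<and> card A = k} = {}"
        using fin N card_mono[OF fin] by force
      show ?thesis unfolding empty by simp
    next
      case True
      \<comment> \<open>In a uniform \<open>k\<close>-subset of \<open>S\<close>,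
        \<open>\<theta>\<close> is the chance that \<open>j\<close> is chosen; \<open>u\<close> is
        the mean weight of the other elements, and 0 if there are none.\<close>
      define u where "u = (\<Sum>x\<in>T. w x) / real N"
      define \<theta> where "\<theta> = real k / real (Suc N)"
      define C where "C = real (Suc N choose k)"
      have sumT: "(\<Sum>x\<in>T. w x) = real N * u"
        using T by (cases "N = 0") (auto simp: u_def)
      have u: "0 \<le> u" "u \<le> w j"
      proof -
        show "0 \<le> u" unfolding u_def using wT by (intro divide_nonneg_nonneg sum_nonneg) auto
        have "(\<Sum>x\<in>T. w x) \<le> real (card T) * w j"
          using j T by (intro sum_bounded_above) auto
        then show "u \<le> w j" unfolding u_def using T wj by (cases "N = 0") (auto simp: field_simps)
      qed
      have \<theta>: "0 \<le> \<theta>" "\<theta> \<le> 1" using True by (auto simp: \<theta>_def)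
      have C1: "real (N choose k') = \<theta> * C"
      proof -
        have "Suc k' * (Suc N choose Suc k') = Suc N * (N choose k')"
          by (metis Suc_times_binomial)
        then have "real (Suc k') * real (Suc N choose Suc k') = real (Suc N) * real (N choose k')"
          by (metis of_nat_mult)
        then show ?thesis using Suc by (simp add: \<theta>_def C_def field_simps del: binomial_Suc_Suc of_nat_Suc)
      qed
      have C2: "real (N choose k) = (1 - \<theta>) * C"
        using C1 Suc by (simp add: C_def algebra_simps)
      have C0: "0 \<le> C" by (simp add: C_def)
      have split: "{A. A \<subseteq> S \<and> card A = k} =
          {A. A \<subseteq> T \<and> card A = k} \<union> insert j ` {A. A \<subseteq> T \<and> card A = k'}" (is "?L = ?R")
      proof (intro equalityI subsetI)
        fix A assume A: "A \<in> ?L"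
        show "A \<in> ?R"
        proof (cases "j \<in> A")
          case True
          have "finite A" using A fin by (auto intro: finite_subset)
          then have "card (A - {j}) = k'" using A True Suc by auto
          moreover have "A - {j} \<subseteq> T" "A = insert j (A - {j})" using A T True by auto
          ultimately show ?thesis by blast
        qed (use A T in auto)
      next
        fix A assume "A \<in> ?R"
        then show "A \<in> ?L"
          using T Suc finite_subset[OF _ T(1)] by (auto simp: card_insert_if subset_iff)
      qed
      have inj: "inj_on (insert j) {A. A \<subseteq> T \<and> card A = k'}"
        using T(2) by (intro inj_onI) (metis (no_types, lifting) insert_ident mem_Collect_eq subsetD)
      have "(\<Sum>A | A \<subseteq> S \<and> card A = k. \<Prod>x\<in>A. 1 - w x) =
          (\<Sum>A | A \<subseteq> T \<and> card A = k. \<Prod>x\<in>A. 1 - w x) +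
          (\<Sum>A | A \<subseteq> T \<and> card A = k'. \<Prod>x\<in>insert j A. 1 - w x)"
        unfolding split using T inj by (subst sum.union_disjoint) (auto simp: sum.reindex)
      also have "(\<Sum>A | A \<subseteq> T \<and> card A = k'. \<Prod>x\<in>insert j A. 1 - w x) =
          (1 - w j) * (\<Sum>A | A \<subseteq> T \<and> card A = k'. \<Prod>x\<in>A. 1 - w x)"
        unfolding sum_distrib_left
      proof (rule sum.cong, goal_cases)
        case (2 A)
        then have "finite A" "j \<notin> A" using T by (auto intro: finite_subset)
        then show ?case by simp
      qed simp
      also have "(\<Sum>A | A \<subseteq> T \<and> card A = k. \<Prod>x\<in>A. 1 - w x) +
          (1 - w j) * (\<Sum>A | A \<subseteq> T \<and> card A = k'. \<Prod>x\<in>A. 1 - w x) \<le>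
          (1 - \<theta>) * C * exp (- (real k / real N * (real N * u))) +
          (1 - w j) * (\<theta> * C * exp (- (real k' / real N * (real N * u))))"
        using IH[of k] IH[of k'] wj unfolding C1 C2 sumT
        by (intro add_mono mult_left_mono) auto
      also have "real k / real N * (real N * u) = real k * u"
        using u_def by (cases "N = 0") auto
      also have "real k' / real N * (real N * u) = real k * u - u"
      proof (cases "N = 0")
        case True
        then have "u = 0" by (simp add: u_def)
        then show ?thesis by simp
      next
        case False
        then show ?thesis using Suc by (simp add: algebra_simps)
      qed
      \<comment> \<open>The common factor taken out here leaves the left-hand side of
        \<open>exp_chord_bound\<close>, with \<open>w j\<close> as the upper end of the range of
        \<open>u\<close>.\<close>
      also have "(1 - \<theta>) * C * exp (- (real k * u)) + (1 - w j) * (\<theta> * C * exp (- (real k * u - u))) =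
         C * exp (- (real k * u - \<theta> * u)) *
         (\<theta> * (1 - w j) * exp ((1 - \<theta>) * u) + (1 - \<theta>) * exp (- (\<theta> * u)))"
      proof -
        have "exp (- (real k * u)) = exp (- (real k * u - \<theta> * u)) * exp (- (\<theta> * u))"
          "exp (- (real k * u - u)) = exp (- (real k * u - \<theta> * u)) * exp ((1 - \<theta>) * u)"
          by (simp_all add: mult_exp_exp algebra_simps)
        then show ?thesis by (simp only: ring_distribs mult_ac)
      qed
      also have "\<dots> \<le> C * exp (- (real k * u - \<theta> * u)) * exp (- (\<theta> * w j))"
        using \<theta> u wj C0 by (intro mult_left_mono exp_chord_bound) auto
      also have "\<dots> = C * exp (- (real k / real (card S) * (\<Sum>x\<in>S. w x)))"
      proof -
        have "\<theta> * real N = real k - \<theta>" by (simp add: \<theta>_def field_simps)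
        then have "(real k - \<theta>) * u + \<theta> * w j = \<theta> * real N * u + \<theta> * w j" by simp
        then have "real k * u - \<theta> * u + \<theta> * w j = \<theta> * (real N * u + w j)"
          by (simp only: left_diff_distrib distrib_left mult.assoc)
        moreover have "(\<Sum>x\<in>S. w x) = real N * u + w j" using T sumT by simp
        ultimately have "real k / real (card S) * (\<Sum>x\<in>S. w x) = real k * u - \<theta> * u + \<theta> * w j"
          unfolding N \<theta>_def by simp
        then show ?thesis by (simp add: mult_exp_exp algebra_simps)
      qed
      finally show ?thesis by (simp add: C_def N)
    qed
  qed
qed

section \<open>Expectations over one uniformly random list\<close>

lemma expectation_before:
  fixes G :: "nat set \<Rightarrow> real"
  assumes "finite S" "h \<in> S"
  shows "measure_pmf.expectation (pmf_of_set (permutations_of_set S)) (\<lambda>xs. G (before xs h)) =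
         (\<Sum>A\<in>Pow (S - {h}). fact (card A) * fact (card S - 1 - card A) * G A) / fact (card S)"
  using assms by (subst integral_pmf_of_set) (auto simp: sum_permutations_of_set_before)

text \<open>The position of \<open>h\<close> relative to \<open>D\<close> is uniform, so the number
  of elements of \<open>D\<close> ahead of \<open>h\<close> takes each value from 0 to
  \<open>card D\<close> with equal probability.\<close>

lemma expectation_power_card_before_Int:
  fixes q :: real
  assumes "finite S" "h \<in> S" "D \<subseteq> S - {h}"
  shows "measure_pmf.expectation (pmf_of_set (permutations_of_set S)) (\<lambda>xs. q ^ card (before xs h \<inter> D)) =
         (\<Sum>k\<le>card D. q ^ k) / real (card D + 1)"
proof -
  let ?T = "S - {h} - D"
  have fin: "finite D" "finite ?T" using assms by (auto intro: finite_subset)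
  have U: "D \<union> ?T = S - {h}" using assms by auto
  have c: "card (S - {h}) = card S - 1" "card S - 1 + 1 = card S"
    using assms card_gt_0_iff[of S] by auto
  show ?thesis
    using sum_Pow_fact_power_card_Int[of ?T D q] fin assms(1,2)
    unfolding U c by (subst expectation_before) (auto simp: c)
qed

text \<open>Conditioning on the rank of \<open>h\<close>: the rank is uniform, and given that
  \<open>k\<close> entries precede \<open>h\<close>, they form a uniform \<open>k\<close>-subset of
  the others.\<close>

lemma expectation_before_by_card:
  fixes G :: "nat set \<Rightarrow> real"
  assumes "finite S" "h \<in> S" and n: "card S = n"
  shows "measure_pmf.expectation (pmf_of_set (permutations_of_set S)) (\<lambda>xs. G (before xs h)) =
         (\<Sum>k<n. (\<Sum>A | A \<subseteq> S - {h} \<and> card A = k. G A) / real (n - 1 choose k)) / real n"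
proof -
  have n0: "n > 0" using assms card_gt_0_iff[of S] by auto
  have c: "card (S - {h}) = n - 1" using assms by simp
  have "(\<Sum>A\<in>Pow (S - {h}). fact (card A) * fact (n - 1 - card A) * G A) =
     (\<Sum>k\<le>n - 1. \<Sum>A | A \<subseteq> S - {h} \<and> card A = k. fact k * fact (n - 1 - k) * G A)"
    using assms(1) by (subst sum_Pow_card) (auto simp: c)
  also have "\<dots> = (\<Sum>k\<le>n - 1. fact (n - 1) * ((\<Sum>A | A \<subseteq> S - {h} \<and> card A = k. G A) / real (n - 1 choose k)))"
  proof (intro sum.cong refl)
    fix k assume "k \<in> {..n - 1}"
    then have "fact k * fact (n - 1 - k) = (fact (n - 1) :: real) / real (n - 1 choose k)"
      by (intro fact_choose_real) auto
    then show "(\<Sum>A | A \<subseteq> S - {h} \<and> card A = k. fact k * fact (n - 1 - k) * G A) =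
        fact (n - 1) * ((\<Sum>A | A \<subseteq> S - {h} \<and> card A = k. G A) / real (n - 1 choose k))"
      unfolding sum_distrib_left[symmetric] by (simp only: times_divide_eq_right times_divide_eq_left)
  qed
  also have "{..n - 1} = {..<n}" using n0 by auto
  also have "(\<Sum>k<n. fact (n - 1) * ((\<Sum>A | A \<subseteq> S - {h} \<and> card A = k. G A) / real (n - 1 choose k))) / fact n =
     (\<Sum>k<n. (\<Sum>A | A \<subseteq> S - {h} \<and> card A = k. G A) / real (n - 1 choose k)) / real n"
    using n0 fact_reduce[of n, where ?'a = real] by (simp only: sum_distrib_left[symmetric]) simp
  finally show ?thesis using assms by (simp add: expectation_before)
qed

lemma expectation_card_before:
  assumes "finite S" "h \<in> S" "l < card S"
  shows "measure_pmf.expectation (pmf_of_set (permutations_of_set S)) (\<lambda>xs. of_bool (card (before xs h) = l) :: real) =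
         1 / real (card S)"
proof -
  have c: "card {A. A \<subseteq> S - {h} \<and> card A = l} = card S - 1 choose l"
    using n_subsets[of "S - {h}" l] assms by simp
  have "(\<Sum>k<card S. (\<Sum>A | A \<subseteq> S - {h} \<and> card A = k. of_bool (card A = l)) / real (card S - 1 choose k)) =
        (\<Sum>k<card S. if k = l then 1 else 0 :: real)"
    using assms c by (intro sum.cong) auto
  also have "\<dots> = 1" using assms by simp
  finally show ?thesis
    unfolding expectation_before_by_card[OF assms(1,2) refl, of "\<lambda>A. of_bool (card A = l)"] by simp
qed

text \<open>Given its size \<open>k\<close>, the set ahead of \<open>h\<close> is a sample without
  replacement, so \<open>sum_subsets_prod_le\<close> bounds the conditional expectation by the
  exponential of minus the mean total weight.\<close>

lemma expectation_prod_before_le: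
  fixes w :: "nat \<Rightarrow> real"
  assumes "finite S" "h \<in> S" and n: "card S = n" and w: "\<And>x. x \<in> S \<Longrightarrow> 0 \<le> w x \<and> w x \<le> 1"
  shows "measure_pmf.expectation (pmf_of_set (permutations_of_set S)) (\<lambda>xs. \<Prod>x\<in>before xs h. 1 - w x) \<le>
         (\<Sum>k<n. exp (- (real k / real (n - 1) * (\<Sum>x\<in>S - {h}. w x)))) / real n"
proof -
  have c: "card (S - {h}) = n - 1" using assms by simp
  have "(\<Sum>A | A \<subseteq> S - {h} \<and> card A = k. \<Prod>x\<in>A. 1 - w x) / real (n - 1 choose k) \<le>
        exp (- (real k / real (n - 1) * (\<Sum>x\<in>S - {h}. w x)))" if "k < n" for k
    using sum_subsets_prod_le[of "S - {h}" w k] assms that c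
    by (simp add: divide_le_eq mult.commute)
  then show ?thesis
    unfolding expectation_before_by_card[OF assms(1-3)]
    by (intro divide_right_mono sum_mono) auto
qed

section \<open>The probability that a matching is stable\<close>

text \<open>This is \<open>p\<close> times the average of \<open>(1 - p) ^ k\<close> over
  \<open>k\<close> from 0 to \<open>d\<close>: the chance that a woman with \<open>d\<close> suitors
  has an admissible pair with her husband and none with a suitor whom she prefers to him.\<close>

definition receive_factor :: "real \<Rightarrow> nat \<Rightarrow> real" where
  "receive_factor p d = (1 - (1 - p) ^ (d + 1)) / real (d + 1)"

definition suitors :: "nat \<Rightarrow> prefs \<Rightarrow> (nat \<Rightarrow> nat) \<Rightarrow> nat \<Rightarrow> nat set" where
  "suitors n mpref M w = {m \<in> {..<n}. w \<in> before (mpref m) (M m)}"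

lemma not_in_before_self: "distinct xs \<Longrightarrow> w \<notin> before xs w"
  by (auto simp: before_def prefers_def nth_eq_iff_index_eq)

lemma before_subset: "before xs h \<subseteq> set xs"
  by (auto simp: before_def prefers_def)

lemma expectation_pair_pmf_finite:
  fixes f :: "'a \<times> 'b \<Rightarrow> real"
  assumes "finite (set_pmf A)" "finite (set_pmf B)"
  shows "measure_pmf.expectation (pair_pmf A B) f =
         measure_pmf.expectation A (\<lambda>a. measure_pmf.expectation B (\<lambda>b. f (a, b)))"
proof -
  have "measure_pmf.expectation (pair_pmf A B) f =
        measure_pmf.expectation (A \<bind> (\<lambda>a. map_pmf (Pair a) B)) f"
    by (simp add: pair_pmf_def map_pmf_def)
  also have "\<dots> = (\<Sum>a\<in>set_pmf A. pmf A a *\<^sub>R measure_pmf.expectation (map_pmf (Pair a) B) f)"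
    using assms by (intro pmf_expectation_bind) auto
  also have "\<dots> = measure_pmf.expectation A (\<lambda>a. measure_pmf.expectation B (\<lambda>b. f (a, b)))"
    using assms by (subst integral_measure_pmf[of "set_pmf A" A]) auto
  finally show ?thesis .
qed

lemma finite_set_random_prefs: "finite (set_pmf (random_prefs n))"
proof -
  have "set_pmf (random_prefs n) \<subseteq> PiE_dflt {..<n} [] (\<lambda>_. permutations_of_set {..<n})"
    unfolding random_prefs_def by (rule order.trans[OF set_Pi_pmf_subset']) auto
  then show ?thesis by (rule finite_subset) (auto intro!: finite_PiE_dflt)
qed

lemma random_prefs_permutation:
  assumes "mp \<in> set_pmf (random_prefs n)" "m < n"
  shows "mp m \<in> permutations_of_set {..<n}"
  using assms set_Pi_pmf_subset'[of "{..<n}" "[]" "\<lambda>_. pmf_of_set (permutations_of_set {..<n})"]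
  by (auto simp: random_prefs_def PiE_dflt_def)

lemma finite_set_random_admissible: "finite (set_pmf (random_admissible n p))"
proof -
  have "set_pmf (random_admissible n p) \<subseteq> PiE_dflt ({..<n} \<times> {..<n}) False (\<lambda>_. UNIV)"
    unfolding random_admissible_def
    by (rule order.trans[OF set_Pi_pmf_subset']) (auto simp: PiE_dflt_def)
  then show ?thesis by (rule finite_subset) (auto intro!: finite_PiE_dflt)
qed

lemma finite_set_matching_model: "finite (set_pmf (matching_model n p))"
  by (simp add: matching_model_def finite_set_random_prefs finite_set_random_admissible)

text \<open>With all lists fixed, stability constrains each pair of a man and a woman separately, so
  independence turns its probability into a product over pairs, which is then grouped by
  women.\<close>

lemma expectation_admissible_stable:
  assumes M: "M permutes {..<n}" and p: "0 \<le> p" "p \<le> 1"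
    and mp: "\<And>m. m < n \<Longrightarrow> distinct (mp m)"
  shows "measure_pmf.expectation (random_admissible n p)
           (\<lambda>adm. of_bool (stable_complete_matching n mp wp adm M)) =
         (\<Prod>w<n. p * (1 - p) ^ card (before (wp w) (inv M w) \<inter> suitors n mp M w))"
proof -
  define bl where "bl m w \<longleftrightarrow> w \<in> before (mp m) (M m) \<and> m \<in> before (wp w) (inv M w)" for m w
  \<comment> \<open>The constraint on one pair: a matched pair must be admissible, a potentially
    blocking pair must not be, any other pair is free.\<close>
  define g :: "nat \<times> nat \<Rightarrow> bool \<Rightarrow> real" where
    "g = (\<lambda>(m, w) b. if M m = w then of_bool b else if bl m w then of_bool (\<not> b) else 1)"
  have "of_bool (stable_complete_matching n mp wp adm M) = (\<Prod>e\<in>{..<n} \<times> {..<n}. g e (adm e))" for adm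
  proof (cases "stable_complete_matching n mp wp adm M")
    case True
    have "g e (adm e) = 1" if "e \<in> {..<n} \<times> {..<n}" for e
      using True that unfolding stable_complete_matching_def g_def bl_def before_def
      by (cases e) auto
    then show ?thesis using True by simp
  next
    case False
    then consider m where "m < n" "\<not> adm (m, M m)"
      | m w where "m < n" "w < n" "adm (m, w)" "M m \<noteq> w" "bl m w"
      using M unfolding stable_complete_matching_def bl_def before_def by auto
    then have "\<exists>e\<in>{..<n} \<times> {..<n}. g e (adm e) = 0"
    proof cases
      case 1
      then have "M m < n" using permutes_in_image[OF M] by auto
      with 1 show ?thesis by (intro bexI[of _ "(m, M m)"]) (auto simp: g_def)
    next
      case 2
      then show ?thesis by (intro bexI[of _ "(m, w)"]) (auto simp: g_def)
    qed
    then show ?thesis using False by simp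
  qed
  then have "measure_pmf.expectation (random_admissible n p)
           (\<lambda>adm. of_bool (stable_complete_matching n mp wp adm M)) =
        measure_pmf.expectation (random_admissible n p) (\<lambda>adm. \<Prod>e\<in>{..<n} \<times> {..<n}. g e (adm e))"
    by simp
  also have "\<dots> = (\<Prod>e\<in>{..<n} \<times> {..<n}. measure_pmf.expectation (bernoulli_pmf p) (g e))"
    unfolding random_admissible_def
    by (rule expectation_prod_Pi_pmf)
       (auto simp: g_def intro!: integrable_measure_pmf_finite)
  also have "\<dots> = (\<Prod>(m, w)\<in>{..<n} \<times> {..<n}. if M m = w then p else if bl m w then 1 - p else 1)"
    using p by (intro prod.cong) (auto simp: g_def)
  also have "\<dots> = (\<Prod>w<n. \<Prod>m<n. if M m = w then p else if bl m w then 1 - p else 1)"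
    by (subst prod.swap) (simp add: prod.cartesian_product)
  also have "\<dots> = (\<Prod>w<n. p * (1 - p) ^ card (before (wp w) (inv M w) \<inter> suitors n mp M w))"
  proof (rule prod.cong, goal_cases)
    case (2 w)
    define h where "h = inv M w"
    have h: "h < n" "M h = w" "\<And>m. M m = w \<longleftrightarrow> m = h"
      using 2 permutes_inverses[OF M] permutes_in_image[OF permutes_inv[OF M], of w]
      by (auto simp: h_def)
    \<comment> \<open>The husband is no suitor of his own wife, so the men other than
      \<open>h\<close> who can block with \<open>w\<close> make up the whole intersection in the
      exponent.\<close>
    have "h \<notin> suitors n mp M w"
      unfolding suitors_def using h(1,2) not_in_before_self[OF mp[OF h(1)], of w] by simp
    then have eq: "{m \<in> {..<n} - {h}. bl m w} = before (wp w) (inv M w) \<inter> suitors n mp M w"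
      by (auto simp: bl_def suitors_def)
    have "(\<Prod>m<n. if M m = w then p else if bl m w then 1 - p else 1) =
          (\<Prod>m<n. if m = h then p else if bl m w then 1 - p else 1)"
      by (simp add: h)
    also have "\<dots> = p * (\<Prod>m\<in>{..<n} - {h}. if m = h then p else if bl m w then 1 - p else 1)"
      using h by (subst prod.remove[of _ h]) auto
    also have "(\<Prod>m\<in>{..<n} - {h}. if m = h then p else if bl m w then 1 - p else 1) =
        (\<Prod>m\<in>{..<n} - {h}. if bl m w then 1 - p else 1)"
      by (intro prod.cong) auto
    also have "\<dots> = (\<Prod>m\<in>{m \<in> {..<n} - {h}. bl m w}. 1 - p)"
      by (rule prod.inter_filter[symmetric]) simp
    also have "\<dots> = (1 - p) ^ card {m \<in> {..<n} - {h}. bl m w}" by simp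
    finally show ?case unfolding eq .
  qed simp
  finally show ?thesis .
qed

text \<open>Admissibility is integrated out first. Then each woman's list enters only her own
  factor, so the expectation over the women's lists is again a product, and a geometric sum turns
  each factor into \<open>receive_factor\<close>.\<close>

lemma expectation_stable:
  assumes M: "M permutes {..<n}" and p: "0 \<le> p" "p \<le> 1"
  shows "measure_pmf.expectation (matching_model n p)
           (\<lambda>(mp, wp, adm). of_bool (stable_complete_matching n mp wp adm M)) =
         measure_pmf.expectation (random_prefs n)
           (\<lambda>mp. \<Prod>w<n. receive_factor p (card (suitors n mp M w)))"
proof -
  have "measure_pmf.expectation (matching_model n p)
           (\<lambda>(mp, wp, adm). of_bool (stable_complete_matching n mp wp adm M) :: real) =
     measure_pmf.expectation (random_prefs n) (\<lambda>mp. measure_pmf.expectation (random_prefs n)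
      (\<lambda>wp. measure_pmf.expectation (random_admissible n p)
           (\<lambda>adm. of_bool (stable_complete_matching n mp wp adm M))))"
    unfolding matching_model_def
    by (simp add: expectation_pair_pmf_finite finite_set_random_prefs finite_set_random_admissible)
  also have "\<dots> = measure_pmf.expectation (random_prefs n)
           (\<lambda>mp. \<Prod>w<n. receive_factor p (card (suitors n mp M w)))"
  proof (rule integral_cong_AE)
    show "AE mp in random_prefs n. measure_pmf.expectation (random_prefs n)
      (\<lambda>wp. measure_pmf.expectation (random_admissible n p)
           (\<lambda>adm. of_bool (stable_complete_matching n mp wp adm M))) =
        (\<Prod>w<n. receive_factor p (card (suitors n mp M w)))"
    proof (rule AE_pmfI)
      fix mp assume "mp \<in> set_pmf (random_prefs n)"
      then have mp: "\<And>m. m < n \<Longrightarrow> distinct (mp m)"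
        using random_prefs_permutation by (auto simp: permutations_of_set_def)
      let ?D = "suitors n mp M"
      have "measure_pmf.expectation (random_prefs n)
         (\<lambda>wp. measure_pmf.expectation (random_admissible n p)
           (\<lambda>adm. of_bool (stable_complete_matching n mp wp adm M))) =
        measure_pmf.expectation (random_prefs n)
          (\<lambda>wp. \<Prod>w<n. p * (1 - p) ^ card (before (wp w) (inv M w) \<inter> ?D w))"
        using expectation_admissible_stable[OF M p mp] by simp
      also have "\<dots> = (\<Prod>w<n. measure_pmf.expectation (pmf_of_set (permutations_of_set {..<n}))
           (\<lambda>xs. p * (1 - p) ^ card (before xs (inv M w) \<inter> ?D w)))"
        unfolding random_prefs_def using p
        by (intro expectation_prod_Pi_pmf) (auto intro!: integrable_measure_pmf_finite)
      also have "\<dots> = (\<Prod>w<n. receive_factor p (card (?D w)))"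
      proof (rule prod.cong, goal_cases)
        case (2 w)
        have h: "inv M w < n" "M (inv M w) = w"
          using 2 permutes_inverses[OF M] permutes_in_image[OF permutes_inv[OF M], of w] by auto
        have "inv M w \<notin> ?D w"
          using h mp[of "inv M w"] not_in_before_self[of "mp (inv M w)" w] by (auto simp: suitors_def)
        then have D: "?D w \<subseteq> {..<n} - {inv M w}" by (auto simp: suitors_def)
        have "measure_pmf.expectation (pmf_of_set (permutations_of_set {..<n}))
           (\<lambda>xs. p * (1 - p) ^ card (before xs (inv M w) \<inter> ?D w)) =
            p * ((\<Sum>k\<le>card (?D w). (1 - p) ^ k) / real (card (?D w) + 1))"
          using h D by (simp only: integral_mult_right_zero)
            (subst expectation_power_card_before_Int, auto)
        also have "\<dots> = receive_factor p (card (?D w))"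
          using sum_gp_basic[of "1 - p" "card (?D w)"] by (simp add: receive_factor_def)
        finally show ?case .
      qed simp
      finally show "measure_pmf.expectation (random_prefs n)
         (\<lambda>wp. measure_pmf.expectation (random_admissible n p)
           (\<lambda>adm. of_bool (stable_complete_matching n mp wp adm M))) =
        (\<Prod>w<n. receive_factor p (card (?D w)))" .
    qed
  qed auto
  finally show ?thesis .
qed

lemma expected_stable_eq:
  assumes p: "0 \<le> p" "p \<le> 1"
  shows "expected_stable n p = (\<Sum>M | M permutes {..<n}.
           measure_pmf.expectation (random_prefs n)
             (\<lambda>mp. \<Prod>w<n. receive_factor p (card (suitors n mp M w))))"
proof -
  have num: "real (num_stable n \<omega>) = (\<Sum>M | M permutes {..<n}.
      (\<lambda>(mp, wp, adm). of_bool (stable_complete_matching n mp wp adm M)) \<omega>)" for \<omega>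
  proof -
    obtain mp wp adm where \<omega>: "\<omega> = (mp, wp, adm)" by (cases \<omega>)
    have "{M. stable_complete_matching n mp wp adm M} =
        {M \<in> {M. M permutes {..<n}}. stable_complete_matching n mp wp adm M}"
      by (auto simp: stable_complete_matching_def)
    then show ?thesis
      by (simp add: \<omega> num_stable_def of_bool_def sum.If_cases finite_permutations Collect_conj_eq)
  qed
  show ?thesis
    unfolding expected_stable_def num
    by (subst Bochner_Integration.integral_sum)
       (auto intro!: sum.cong integrable_measure_pmf_finite finite_set_matching_model expectation_stable p)
qed

section \<open>Upper bound\<close>

text \<open>The counterpart of \<open>receive_factor\<close> with \<open>(1 - p * y) ^ d\<close>
  replaced by \<open>exp (- (p * s * y))\<close> under the integral over \<open>y\<close> in
  \<open>[0,1]\<close>; the value at \<open>s = 0\<close> is the one that the integral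
  gives.\<close>

definition exp_factor :: "real \<Rightarrow> real \<Rightarrow> real" where
  "exp_factor p s = (if s = 0 then p else (1 - exp (- (p * s))) / s)"

abbreviation unit_lborel :: "real measure" where
  "unit_lborel \<equiv> restrict_space lborel {0..1}"

lemma prob_space_unit_lborel: "prob_space unit_lborel"
  by (rule prob_spaceI) (simp add: space_restrict_space emeasure_restrict_space)

lemma integral_unit_lborel_FTC:
  fixes f F :: "real \<Rightarrow> real"
  assumes "\<And>x. (F has_real_derivative f x) (at x)" "\<And>x. isCont f x"
  shows "integrable unit_lborel f" "integral\<^sup>L unit_lborel f = F 1 - F 0"
proof -
  have "has_bochner_integral lborel (\<lambda>x. f x * indicator {0..1} x) (F 1 - F 0)"
    using assms by (intro has_bochner_integral_FTC_Icc_real) auto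
  then have I: "has_bochner_integral lborel (\<lambda>x. indicator {0..1} x *\<^sub>R f x) (F 1 - F 0)"
    by (simp add: mult.commute)
  then show "integrable unit_lborel f"
    by (subst integrable_restrict_space) (auto simp: has_bochner_integral_iff)
  show "integral\<^sup>L unit_lborel f = F 1 - F 0"
    using I by (subst integral_restrict_space) (auto simp: has_bochner_integral_iff)
qed

text \<open>The integral moves \<open>d\<close> into an exponent, so that a product over women, each
  with her number of suitors as exponent, can be regrouped by men.\<close>

lemma receive_factor_integral:
  assumes "0 < p"
  shows "integrable unit_lborel (\<lambda>y. (1 - p * y) ^ d)"
    and "receive_factor p d = p * integral\<^sup>L unit_lborel (\<lambda>y. (1 - p * y) ^ d)"
proof -
  let ?F = "\<lambda>y. - ((1 - p * y) ^ Suc d / (p * real (Suc d)))"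
  have "(?F has_real_derivative (1 - p * x) ^ d) (at x)" for x
    using assms by (auto intro!: derivative_eq_intros simp del: power_Suc of_nat_Suc)
  note I = integral_unit_lborel_FTC[OF this]
  show "integrable unit_lborel (\<lambda>y. (1 - p * y) ^ d)" by (intro I) auto
  have "integral\<^sup>L unit_lborel (\<lambda>y. (1 - p * y) ^ d) = ?F 1 - ?F 0" by (intro I) auto
  also have "\<dots> = (1 - (1 - p) ^ Suc d) / (p * real (Suc d))"
    by (simp add: diff_divide_distrib del: power_Suc of_nat_Suc)
  finally show "receive_factor p d = p * integral\<^sup>L unit_lborel (\<lambda>y. (1 - p * y) ^ d)"
    using assms by (simp add: receive_factor_def)
qed

lemma exp_factor_integral:
  assumes "0 < p"
  shows "integrable unit_lborel (\<lambda>y. exp (- (p * s * y)))"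
    and "exp_factor p s = p * integral\<^sup>L unit_lborel (\<lambda>y. exp (- (p * s * y)))"
proof -
  have "integrable unit_lborel (\<lambda>y. exp (- (p * s * y))) \<and>
        exp_factor p s = p * integral\<^sup>L unit_lborel (\<lambda>y. exp (- (p * s * y)))"
  proof (cases "s = 0")
    case True
    interpret prob_space unit_lborel by (rule prob_space_unit_lborel)
    have "prob {0..1} = 1" using prob_space by (simp add: space_restrict_space)
    then show ?thesis using True by (simp add: exp_factor_def)
  next
    case False
    let ?F = "\<lambda>y. - (exp (- (p * s * y)) / (p * s))"
    have "(?F has_real_derivative exp (- (p * s * x))) (at x)" for x
      using assms False by (auto intro!: derivative_eq_intros simp: field_simps)
    note I = integral_unit_lborel_FTC[OF this]
    have "integrable unit_lborel (\<lambda>y. exp (- (p * s * y)))" by (intro I) auto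
    moreover have "integral\<^sup>L unit_lborel (\<lambda>y. exp (- (p * s * y))) = ?F 1 - ?F 0"
      by (intro I) auto
    ultimately show ?thesis
      using assms False by (simp add: exp_factor_def field_simps)
  qed
  then show "integrable unit_lborel (\<lambda>y. exp (- (p * s * y)))"
    "exp_factor p s = p * integral\<^sup>L unit_lborel (\<lambda>y. exp (- (p * s * y)))" by auto
qed

section \<open>From women to men and back in the upper bound\<close>

text \<open>Grouped by men, the factors depend on independent lists and
  \<open>expectation_prod_before_le\<close> applies to each. Expanding the product of sums gives a
  sum over vectors \<open>k\<close>, where \<open>k m\<close> is the rank of the wife of
  \<open>m\<close> minus one, and the exponents are finally regrouped by women.\<close>

lemma expectation_prod_suitors_le:
  assumes M: "M permutes {..<n}" and p: "0 < p" "p \<le> 1"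
    and Y: "\<And>w. w < n \<Longrightarrow> 0 \<le> Y w \<and> Y w \<le> 1"
  shows "measure_pmf.expectation (random_prefs n)
           (\<lambda>mp. \<Prod>w<n. (1 - p * Y w) ^ card (suitors n mp M w)) \<le>
         (\<Sum>k\<in>PiE {..<n} (\<lambda>_. {..<n}).
            \<Prod>w<n. exp (- (p * (\<Sum>m\<in>{..<n} - {inv M w}. real (k m) / real (n - 1)) * Y w))) / real n ^ n"
proof -
  have pY: "0 \<le> p * Y w \<and> p * Y w \<le> 1" if "w < n" for w
    using Y[OF that] p by (auto intro: mult_le_one)
  have M_lt: "M m < n" if "m < n" for m using permutes_in_image[OF M, of m] that by auto
  have inv_eq: "M m = w \<longleftrightarrow> m = inv M w" for m w
    using permutes_inverses[OF M] by metis
  \<comment> \<open>The intersection with \<open>{..<n}\<close> makes the exchange of the products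
    valid for every \<open>mp\<close>, not only for those in the support.\<close>
  let ?B = "\<lambda>m xs. before xs (M m) \<inter> {..<n}"
  have "(\<Prod>w<n. (1 - p * Y w) ^ card (suitors n mp M w)) =
        (\<Prod>m<n. \<Prod>w\<in>?B m (mp m). 1 - p * Y w)" for mp
  proof -
    have "(\<Prod>w<n. (1 - p * Y w) ^ card (suitors n mp M w)) =
        (\<Prod>w<n. \<Prod>m<n. if w \<in> before (mp m) (M m) then 1 - p * Y w else 1)"
    proof (rule prod.cong, goal_cases)
      case (2 w)
      have "(\<Prod>m<n. if w \<in> before (mp m) (M m) then 1 - p * Y w else 1) =
        (\<Prod>m\<in>{m\<in>{..<n}. w \<in> before (mp m) (M m)}. 1 - p * Y w)"
        by (rule prod.inter_filter[symmetric]) simp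
      then show ?case by (simp add: suitors_def)
    qed simp
    also have "\<dots> = (\<Prod>m<n. \<Prod>w<n. if w \<in> before (mp m) (M m) then 1 - p * Y w else 1)"
      by (rule prod.swap)
    also have "\<dots> = (\<Prod>m<n. \<Prod>w\<in>?B m (mp m). 1 - p * Y w)"
    proof (rule prod.cong, goal_cases)
      case (2 m)
      have "(\<Prod>w<n. if w \<in> before (mp m) (M m) then 1 - p * Y w else 1) =
        (\<Prod>w\<in>{w\<in>{..<n}. w \<in> before (mp m) (M m)}. 1 - p * Y w)"
        by (rule prod.inter_filter[symmetric]) simp
      also have "{w\<in>{..<n}. w \<in> before (mp m) (M m)} = ?B m (mp m)" by auto
      finally show ?case .
    qed simp
    finally show ?thesis .
  qed
  then have "measure_pmf.expectation (random_prefs n)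
           (\<lambda>mp. \<Prod>w<n. (1 - p * Y w) ^ card (suitors n mp M w)) =
        measure_pmf.expectation (random_prefs n) (\<lambda>mp. \<Prod>m<n. \<Prod>w\<in>?B m (mp m). 1 - p * Y w)"
    by simp
  also have "\<dots> = (\<Prod>m<n. measure_pmf.expectation (pmf_of_set (permutations_of_set {..<n}))
      (\<lambda>xs. \<Prod>w\<in>?B m xs. 1 - p * Y w))"
    unfolding random_prefs_def using pY
    by (intro expectation_prod_Pi_pmf) (auto intro!: integrable_measure_pmf_finite prod_nonneg)
  also have "\<dots> \<le> (\<Prod>m<n. (\<Sum>k<n. exp (- (real k / real (n - 1) * (\<Sum>w\<in>{..<n} - {M m}. p * Y w)))) / real n)"
  proof (rule prod_mono, goal_cases)
    case (1 m)
    then have m: "M m < n" using M_lt by auto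
    have "measure_pmf.expectation (pmf_of_set (permutations_of_set {..<n}))
        (\<lambda>xs. \<Prod>w\<in>?B m xs. 1 - p * Y w) =
       measure_pmf.expectation (pmf_of_set (permutations_of_set {..<n}))
        (\<lambda>xs. \<Prod>w\<in>before xs (M m). 1 - p * Y w)"
    proof (rule integral_cong_AE)
      show "AE xs in pmf_of_set (permutations_of_set {..<n}).
          (\<Prod>w\<in>?B m xs. 1 - p * Y w) = (\<Prod>w\<in>before xs (M m). 1 - p * Y w)"
      proof (rule AE_pmfI)
        fix xs assume "xs \<in> set_pmf (pmf_of_set (permutations_of_set {..<n}))"
        then have "xs \<in> permutations_of_set {..<n}" by simp
        then have "set xs = {..<n}" by (simp add: permutations_of_set_def)
        then have "before xs (M m) \<subseteq> {..<n}" using before_subset[of xs "M m"] by simp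
        then show "(\<Prod>w\<in>?B m xs. 1 - p * Y w) = (\<Prod>w\<in>before xs (M m). 1 - p * Y w)"
          by (simp add: Int_absorb2)
      qed
    qed auto
    also have "\<dots> \<le> (\<Sum>k<n. exp (- (real k / real (n - 1) * (\<Sum>w\<in>{..<n} - {M m}. p * Y w)))) / real n"
      using m pY by (intro expectation_prod_before_le) auto
    finally show ?case using pY
      by (intro conjI integral_nonneg_AE AE_pmfI prod_nonneg) auto
  qed
  also have "\<dots> = (\<Sum>k\<in>PiE {..<n} (\<lambda>_. {..<n}).
      \<Prod>m<n. exp (- (real (k m) / real (n - 1) * (\<Sum>w\<in>{..<n} - {M m}. p * Y w)))) / real n ^ n"
    by (simp add: prod_dividef prod_sum_PiE)
  also have "(\<Sum>k\<in>PiE {..<n} (\<lambda>_. {..<n}).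
      \<Prod>m<n. exp (- (real (k m) / real (n - 1) * (\<Sum>w\<in>{..<n} - {M m}. p * Y w)))) =
    (\<Sum>k\<in>PiE {..<n} (\<lambda>_. {..<n}).
      \<Prod>w<n. exp (- (p * (\<Sum>m\<in>{..<n} - {inv M w}. real (k m) / real (n - 1)) * Y w)))"
  proof (rule sum.cong, goal_cases)
    case (2 k)
    have "(\<Sum>m<n. real (k m) / real (n - 1) * (\<Sum>w\<in>{..<n} - {M m}. p * Y w)) =
      (\<Sum>m<n. \<Sum>w<n. if M m = w then 0 else real (k m) / real (n - 1) * (p * Y w))"
    proof (rule sum.cong, goal_cases)
      case (2 m)
      have "(\<Sum>w\<in>{..<n} - {M m}. p * Y w) = (\<Sum>w\<in>{w\<in>{..<n}. M m \<noteq> w}. p * Y w)"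
        by (rule sum.cong) auto
      also have "\<dots> = (\<Sum>w<n. if M m \<noteq> w then p * Y w else 0)"
        by (rule sum.inter_filter) simp
      finally show ?case by (auto simp: sum_distrib_left intro!: sum.cong)
    qed simp
    also have "\<dots> = (\<Sum>w<n. \<Sum>m<n. if M m = w then 0 else real (k m) / real (n - 1) * (p * Y w))"
      by (rule sum.swap)
    also have "\<dots> = (\<Sum>w<n. p * (\<Sum>m\<in>{..<n} - {inv M w}. real (k m) / real (n - 1)) * Y w)"
    proof (rule sum.cong, goal_cases)
      case (2 w)
      have "(\<Sum>m\<in>{..<n} - {inv M w}. real (k m) / real (n - 1)) =
          (\<Sum>m\<in>{m\<in>{..<n}. M m \<noteq> w}. real (k m) / real (n - 1))"
        by (rule sum.cong) (auto simp: inv_eq)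
      also have "\<dots> = (\<Sum>m<n. if M m \<noteq> w then real (k m) / real (n - 1) else 0)"
        by (rule sum.inter_filter) simp
      finally show ?case by (auto simp: sum_distrib_left sum_distrib_right intro!: sum.cong)
    qed simp
    finally show ?case by (simp add: exp_sum[symmetric] sum_negf)
  qed simp
  finally show ?thesis .
qed

text \<open>With every factor written as an integral, the product becomes an integral over the unit
  cube. There the average over the men's lists is bounded pointwise, and integrating the coordinates
  separately turns the exponentials into \<open>exp_factor\<close>.\<close>

lemma expectation_stable_le:
  assumes M: "M permutes {..<n}" and p: "0 < p" "p \<le> 1"
  shows "measure_pmf.expectation (random_prefs n)
           (\<lambda>mp. \<Prod>w<n. receive_factor p (card (suitors n mp M w))) \<le>
         (\<Sum>k\<in>PiE {..<n} (\<lambda>_. {..<n}).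
            \<Prod>m<n. exp_factor p (\<Sum>i\<in>{..<n} - {m}. real (k i) / real (n - 1))) / real n ^ n"
proof -
  interpret unit: product_prob_space "\<lambda>_::nat. unit_lborel"
    by (intro product_prob_spaceI prob_space_unit_lborel)
  let ?S = "set_pmf (random_prefs n)" and ?P = "PiM {..<n} (\<lambda>_. unit_lborel)"
  let ?K = "PiE {..<n} (\<lambda>_. {..<n})"
  let ?s = "\<lambda>k m. \<Sum>i\<in>{..<n} - {m}. real (k i) / real (n - 1)"
  let ?D = "\<lambda>mp w. card (suitors n mp M w)"
  have int1: "integrable ?P (\<lambda>Y. \<Prod>w<n. (1 - p * Y w) ^ ?D mp w)" for mp
    using unit.product_integrable_prod[of "{..<n}" "\<lambda>w y. (1 - p * y) ^ ?D mp w"]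
      receive_factor_integral(1)[OF p(1)] by simp
  have int2: "integrable ?P (\<lambda>Y. \<Prod>w<n. exp (- (p * ?s k (inv M w) * Y w)))" for k
    using unit.product_integrable_prod[of "{..<n}" "\<lambda>w y. exp (- (p * ?s k (inv M w) * y))"]
      exp_factor_integral(1)[OF p(1)] by simp
  have "measure_pmf.expectation (random_prefs n) (\<lambda>mp. \<Prod>w<n. receive_factor p (?D mp w)) =
        (\<Sum>mp\<in>?S. pmf (random_prefs n) mp * (p ^ n * (\<integral>Y. (\<Prod>w<n. (1 - p * Y w) ^ ?D mp w) \<partial>?P)))"
  proof (subst integral_measure_pmf[of ?S], goal_cases)
    case 3
    have "(\<Prod>w<n. receive_factor p (?D mp w)) = p ^ n * (\<integral>Y. (\<Prod>w<n. (1 - p * Y w) ^ ?D mp w) \<partial>?P)" for mp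
      using unit.product_integral_prod[of "{..<n}" "\<lambda>w y. (1 - p * y) ^ ?D mp w"]
        receive_factor_integral[OF p(1)] by (simp add: prod.distrib)
    then show ?case by simp
  qed (auto simp: finite_set_random_prefs)
  also have "\<dots> = p ^ n * (\<integral>Y. (\<Sum>mp\<in>?S. pmf (random_prefs n) mp * (\<Prod>w<n. (1 - p * Y w) ^ ?D mp w)) \<partial>?P)"
    using int1 by (subst Bochner_Integration.integral_sum) (auto simp: sum_distrib_left mult_ac)
  also have "\<dots> \<le> p ^ n * (\<integral>Y. (\<Sum>k\<in>?K. \<Prod>w<n. exp (- (p * ?s k (inv M w) * Y w))) / real n ^ n \<partial>?P)"
  proof (intro mult_left_mono integral_mono)
    fix Y assume "Y \<in> space ?P"
    then have Y: "\<And>w. w < n \<Longrightarrow> 0 \<le> Y w \<and> Y w \<le> 1"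
      by (auto simp: space_PiM space_restrict_space PiE_def Pi_def)
    have "(\<Sum>mp\<in>?S. pmf (random_prefs n) mp * (\<Prod>w<n. (1 - p * Y w) ^ ?D mp w)) =
      measure_pmf.expectation (random_prefs n) (\<lambda>mp. \<Prod>w<n. (1 - p * Y w) ^ ?D mp w)"
      by (subst integral_measure_pmf[of ?S]) (auto simp: finite_set_random_prefs)
    also have "\<dots> \<le> (\<Sum>k\<in>?K. \<Prod>w<n. exp (- (p * ?s k (inv M w) * Y w))) / real n ^ n"
      using expectation_prod_suitors_le[OF M p Y] .
    finally show "(\<Sum>mp\<in>?S. pmf (random_prefs n) mp * (\<Prod>w<n. (1 - p * Y w) ^ ?D mp w)) \<le> \<dots>" .
  qed (use p int1 int2 in \<open>auto intro!: Bochner_Integration.integrable_sum integrable_mult_right integrable_divide\<close>)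
  also have "\<dots> = (\<Sum>k\<in>?K. p ^ n * (\<integral>Y. (\<Prod>w<n. exp (- (p * ?s k (inv M w) * Y w))) \<partial>?P)) / real n ^ n"
    using int2 by (subst integral_divide_zero) (simp add: Bochner_Integration.integral_sum sum_distrib_left)
  also have "\<dots> = (\<Sum>k\<in>?K. \<Prod>m<n. exp_factor p (?s k m)) / real n ^ n"
  proof -
    have "p ^ n * (\<integral>Y. (\<Prod>w<n. exp (- (p * ?s k (inv M w) * Y w))) \<partial>?P) =
        (\<Prod>w<n. exp_factor p (?s k (inv M w)))" for k
      using unit.product_integral_prod[of "{..<n}" "\<lambda>w y. exp (- (p * ?s k (inv M w) * y))"]
        exp_factor_integral[OF p(1)] by (simp add: prod.distrib)
    \<comment> \<open>The husbands of all women are all men, each once.\<close>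
    also have "(\<Prod>w<n. exp_factor p (?s k (inv M w))) = (\<Prod>m<n. exp_factor p (?s k m))" for k
      using prod.permute[OF permutes_inv[OF M], of "\<lambda>m. exp_factor p (?s k m)"] by (simp add: o_def)
    finally show ?thesis by simp
  qed
  finally show ?thesis .
qed

section \<open>Elementary estimates and rank vectors with a given sum\<close>

lemma exp_factor_nonneg: "0 \<le> p \<Longrightarrow> 0 \<le> s \<Longrightarrow> 0 \<le> exp_factor p s"
  by (simp add: exp_factor_def)

lemma exp_factor_le: 
  assumes "0 \<le> p" "0 \<le> s"
  shows "exp_factor p s \<le> p"
proof (cases "s = 0")
  case False
  then have "1 - exp (- (p * s)) \<le> p * s"
    using exp_ge_add_one_self[of "- (p * s)"] by simp
  then show ?thesis using False assms by (simp add: exp_factor_def divide_le_eq)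
qed (simp add: exp_factor_def)

lemma one_minus_power_le_exp:
  fixes x :: real
  assumes "x \<le> 1"
  shows "(1 - x) ^ n \<le> exp (- (real n * x))"
proof -
  have "(1 - x) ^ n \<le> exp (- x) ^ n"
    using assms exp_ge_add_one_self[of "- x"] by (intro power_mono) auto
  then show ?thesis by (simp add: exp_of_nat_mult[symmetric])
qed

text \<open>A Stirling bound with a linear factor to spare; the induction step comes down to
  \<open>exp 1 * x ^ Suc n \<le> 1\<close> for \<open>x = n / (n + 1)\<close>.\<close>

lemma fact_mult_exp_le:
  assumes "n > 0"
  shows "fact n * (exp 1 / real n) ^ n \<le> exp 1 * real n"
  using assms
proof (induction n rule: nat_induct_non_zero)
  case (Suc n)
  define x where "x = real n / real (Suc n)"
  have x: "0 < x" "1 - x = 1 / real (Suc n)" using Suc by (auto simp: x_def field_simps)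
  have "exp 1 * x ^ Suc n = exp 1 * (1 - (1 - x)) ^ Suc n" by simp
  also have "\<dots> \<le> exp 1 * exp (- (real (Suc n) * (1 - x)))"
    using x by (intro mult_left_mono one_minus_power_le_exp) auto
  also have "\<dots> = 1" using x by (simp add: mult_exp_exp)
  finally have step: "exp 1 * x ^ Suc n \<le> 1" .
  have "fact (Suc n) * (exp 1 / real (Suc n)) ^ Suc n =
        (fact n * (exp 1 / real n) ^ n) * (exp 1 * x ^ n)"
  proof -
    have "exp 1 / real (Suc n) = (exp 1 / real n) * x" using Suc by (simp add: x_def)
    then have "(exp 1 / real (Suc n)) ^ n = (exp 1 / real n) ^ n * x ^ n"
      by (simp only: power_mult_distrib)
    then have "(exp 1 / real (Suc n)) ^ Suc n = exp 1 / real (Suc n) * ((exp 1 / real n) ^ n * x ^ n)"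
      by (simp only: power_Suc)
    then show ?thesis by simp
  qed
  also have "\<dots> \<le> (exp 1 * real n) * (exp 1 * x ^ n)"
    using Suc x by (intro mult_right_mono) auto
  also have "\<dots> = exp 1 * real (Suc n) * (exp 1 * x ^ Suc n)"
    by (simp add: x_def)
  also have "\<dots> \<le> exp 1 * real (Suc n) * 1"
    using step by (intro mult_left_mono) auto
  finally show ?case by simp
qed simp

text \<open>Multiplication by \<open>exp l - 1\<close> makes the geometric sum telescope, and
  \<open>exp l - 1\<close> is at least \<open>l\<close>.\<close>

lemma sum_exp_neg_le:
  fixes l :: real
  assumes "l > 0"
  shows "(\<Sum>j<n. exp (- (l * real (j + 1)))) \<le> (1 - exp (- (l * real n))) / l"
proof -
  let ?S = "\<Sum>j<n. exp (- (l * real (j + 1)))"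
  have "?S * (exp l - 1) = 1 - exp (- (l * real n))"
    by (induction n) (auto simp: algebra_simps mult_exp_exp)
  moreover have "l \<le> exp l - 1" using exp_ge_add_one_self[of l] by linarith
  then have "?S * l \<le> ?S * (exp l - 1)" by (intro mult_left_mono sum_nonneg) auto
  ultimately show ?thesis using assms by (simp add: pos_le_divide_eq)
qed

text \<open>Chernoff bound with the tilt \<open>n / R\<close>.\<close>

lemma card_PiE_sum_eq_le:
  fixes n T :: nat
  assumes n: "n > 0" and R: "R = real (T + n)"
  shows "real (card {k \<in> PiE {..<n} (\<lambda>_. {..<n}). (\<Sum>m<n. k m) = T}) \<le>
         (exp 1 * R / real n) ^ n * (1 - exp (- ((real n)\<^sup>2 / R))) ^ n"
proof -
  let ?K = "PiE {..<n} (\<lambda>_. {..<n})"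
  let ?A = "{k \<in> ?K. (\<Sum>m<n. k m) = T}"
  define l where "l = real n / R"
  have Rpos: "R > 0" and l: "l > 0" using n R by (auto simp: l_def)
  have fin: "finite ?K" by (intro finite_PiE) auto
  have val: "(\<Prod>m<n. exp (- (l * real (k m + 1)))) = exp (- real n)" if "k \<in> ?A" for k
  proof -
    have "(\<Sum>m<n. real (k m + 1)) = real (\<Sum>m<n. k m) + real n"
      by (simp add: sum.distrib)
    also have "\<dots> = R" using that R by simp
    finally have "(\<Sum>m<n. l * real (k m + 1)) = real n"
      unfolding sum_distrib_left[symmetric] using Rpos by (simp add: l_def)
    then show ?thesis by (simp add: exp_sum[symmetric] sum_negf)
  qed
  have "real (card ?A) * exp (- real n) = (\<Sum>k\<in>?A. \<Prod>m<n. exp (- (l * real (k m + 1))))"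
    using val by simp
  \<comment> \<open>Dropping the condition on the sum lets the total weight factor over the
    coordinates.\<close>
  also have "\<dots> \<le> (\<Sum>k\<in>?K. \<Prod>m<n. exp (- (l * real (k m + 1))))"
  proof (rule sum_mono2[OF fin])
    show "?A \<subseteq> ?K" by (rule Collect_restrict)
    show "0 \<le> (\<Prod>m<n. exp (- (l * real (k m + 1))))" for k :: "nat \<Rightarrow> nat"
      by (intro prod_nonneg) simp
  qed
  also have "\<dots> = (\<Sum>j<n. exp (- (l * real (j + 1)))) ^ n"
    using prod_sum_PiE[of "{..<n}" "\<lambda>_. {..<n}" "\<lambda>_ j. exp (- (l * real (j + 1)))"] by simp
  also have "\<dots> \<le> ((1 - exp (- (l * real n))) / l) ^ n"
    using sum_exp_neg_le[OF l, of n] by (intro power_mono sum_nonneg) auto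
  also have "\<dots> = (R / real n) ^ n * (1 - exp (- ((real n)\<^sup>2 / R))) ^ n"
    by (simp add: l_def power_divide power2_eq_square power_mult_distrib)
  finally have "real (card ?A) * exp (- real n) * exp (real n) \<le>
      (R / real n) ^ n * (1 - exp (- ((real n)\<^sup>2 / R))) ^ n * exp (real n)"
    by (intro mult_right_mono) auto
  also have "real (card ?A) * exp (- real n) * exp (real n) = real (card ?A)"
    unfolding mult.assoc mult_exp_exp by (simp only: add.left_inverse exp_zero mult_1_right)
  also have "exp (real n) = exp 1 ^ n" by (simp add: exp_of_nat_mult[symmetric])
  also have "(R / real n) ^ n * (1 - exp (- ((real n)\<^sup>2 / R))) ^ n * exp 1 ^ n =
      (exp 1 * R / real n) ^ n * (1 - exp (- ((real n)\<^sup>2 / R))) ^ n"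
    unfolding power_mult_distrib power_divide by simp
  finally show ?thesis .
qed

lemma one_le_mult_exp:
  fixes x :: real
  assumes "0 \<le> x" "x \<le> 1 / 2"
  shows "1 \<le> (1 - x) * exp (2 * x)"
proof -
  have "1 + x * (1 - 2 * x) \<le> (1 - x) * exp (2 * x)"
    using mult_left_mono[OF exp_ge_add_one_self[of "2 * x"], of "1 - x"] assms
    by (simp add: algebra_simps)
  moreover have "0 \<le> x * (1 - 2 * x)" using assms by simp
  ultimately show ?thesis by linarith
qed

text \<open>Every argument lies between \<open>R / n - 2\<close> and \<open>R / n\<close>. Replacing
  it by \<open>R / n\<close> costs at most \<open>exp (4 * n / R)\<close> per factor, hence the
  middle factor of the bound after \<open>n\<close> replacements.\<close>

lemma prod_exp_factor_le:
  fixes n T :: nat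
  assumes n: "n \<ge> 2" and p: "0 < p" and k: "k \<in> PiE {..<n} (\<lambda>_. {..<n})" "(\<Sum>m<n. k m) = T"
    and R: "R = real (T + n)" "R / real n \<ge> 4"
  shows "(\<Prod>m<n. exp_factor p (\<Sum>i\<in>{..<n} - {m}. real (k i) / real (n - 1))) \<le>
         (real n / R) ^ n * exp (4 * ((real n)\<^sup>2 / R)) * (1 - exp (- (p * R / real n))) ^ n"
proof -
  let ?s = "\<lambda>m. \<Sum>i\<in>{..<n} - {m}. real (k i) / real (n - 1)"
  have Rpos: "R > 0" using n R by auto
  have kn: "k m \<le> n - 1" if "m < n" for m using k(1) that by (auto simp: PiE_def Pi_def)
  have Tn: "real T \<le> real n * real (n - 1)"
    using sum_bounded_above[of "{..<n}" k "n - 1"] kn k(2)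
    by (metis card_lessThan lessThan_iff of_nat_id of_nat_mono of_nat_mult)
  have n1: "real (n - 1) = real n - 1" using n by simp
  \<comment> \<open>One unit is lost by leaving out \<open>k m\<close>, which is at most
    \<open>n - 1\<close> before the division, and one because \<open>R\<close> contains
    \<open>n\<close> in addition to \<open>T\<close>. The upper bound uses
    \<open>T \<le> n * (n - 1)\<close>.\<close>
  have s: "?s m \<ge> R / real n - 2" "?s m \<le> R / real n" if m: "m < n" for m
  proof -
    have "(\<Sum>i<n. real (k i)) = real (k m) + (\<Sum>i\<in>{..<n} - {m}. real (k i))"
      using m by (subst sum.remove[of _ m]) auto
    moreover have "(\<Sum>i<n. real (k i)) = real T" unfolding k(2)[symmetric] by simp
    ultimately have "(\<Sum>i\<in>{..<n} - {m}. real (k i)) = real T - real (k m)" by linarith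
    then have s_eq: "?s m = (real T - real (k m)) / real (n - 1)"
      unfolding sum_divide_distrib[symmetric] by (simp only:)
    have "real (k m) \<le> real (n - 1)" using kn[OF m] by simp
    then have "?s m \<ge> (real T - real (n - 1)) / real (n - 1)"
      unfolding s_eq by (intro divide_right_mono) auto
    moreover have "(real T - real (n - 1)) / real (n - 1) = real T / real (n - 1) - 1"
      using n by (simp add: diff_divide_distrib)
    moreover have "real T / real (n - 1) \<ge> real T / real n"
      using n by (intro divide_left_mono) auto
    ultimately have "real T / real n - 1 \<le> ?s m"
      using order.trans[of "real T / real n - 1" "real T / real (n - 1) - 1" "?s m"] by simp
    then show "?s m \<ge> R / real n - 2" using n by (simp add: R add_divide_distrib)
    have "?s m \<le> real T / real (n - 1)" unfolding s_eq by (intro divide_right_mono) auto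
    also have "\<dots> \<le> R / real n" using Tn n by (simp add: R n1 field_simps)
    finally show "?s m \<le> R / real n" .
  qed
  define c where "c = real n / R * exp (4 * (real n / R)) * (1 - exp (- (p * R / real n)))"
  have "exp_factor p (?s m) \<le> c" if m: "m < n" for m
  proof -
    define t where "t = ?s m"
    have t: "t > 0" "t \<ge> R / real n - 2" "t \<le> R / real n"
      using s[OF m] R(2) by (auto simp: t_def)
    have "exp_factor p t = 1 / t * (1 - exp (- (p * t)))" using t by (simp add: exp_factor_def)
    also have "\<dots> \<le> (real n / R * exp (4 * (real n / R))) * (1 - exp (- (p * R / real n)))"
    proof (intro mult_mono)
      \<comment> \<open>The lower bound 4 on \<open>R / n\<close> puts \<open>2 * n / R\<close> into
        the range of \<open>one_le_mult_exp\<close>.\<close>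
      have "1 \<le> (1 - 2 * (real n / R)) * exp (2 * (2 * (real n / R)))"
        using R(2) Rpos n by (intro one_le_mult_exp) (auto simp: field_simps)
      then have "1 * (R / real n) \<le> (1 - 2 * (real n / R)) * exp (2 * (2 * (real n / R))) * (R / real n)"
        using Rpos by (intro mult_right_mono) auto
      also have "\<dots> = (R / real n - 2) * exp (4 * (real n / R))"
        using Rpos n by (simp add: field_simps)
      also have "\<dots> \<le> t * exp (4 * (real n / R))"
        using t by (intro mult_right_mono) auto
      finally have "R / real n \<le> t * exp (4 * (real n / R))" by simp
      then show "1 / t \<le> real n / R * exp (4 * (real n / R))"
        using t Rpos n by (simp add: field_simps)
      have "p * t \<le> p * (R / real n)" using t p by (intro mult_left_mono) auto
      then show "1 - exp (- (p * t)) \<le> 1 - exp (- (p * R / real n))" by simp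
    qed (use t p Rpos in auto)
    finally show ?thesis by (simp add: t_def c_def)
  qed
  moreover have "0 \<le> exp_factor p (?s m)" if "m < n" for m
    using p by (intro exp_factor_nonneg sum_nonneg) auto
  ultimately have "(\<Prod>m<n. exp_factor p (?s m)) \<le> (\<Prod>m<n. c)"
    by (intro prod_mono) auto
  also have "\<dots> = (real n / R) ^ n * exp (4 * ((real n)\<^sup>2 / R)) * (1 - exp (- (p * R / real n))) ^ n"
  proof -
    have "real n * (4 * (real n / R)) = 4 * ((real n)\<^sup>2 / R)" by (simp add: power2_eq_square)
    then have "exp (4 * (real n / R)) ^ n = exp (4 * ((real n)\<^sup>2 / R))"
      by (metis exp_of_nat_mult)
    then show ?thesis unfolding c_def prod_constant power_mult_distrib by simp
  qed
  finally show ?thesis .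
qed

section \<open>Upper bound summed over the total rank\<close>

text \<open>The factor \<open>n\<^sup>2\<close> counts the values of \<open>T\<close>, and
  \<open>exp 1 * n\<close> is the loss in the Stirling bound. The three terms belong to small
  \<open>R\<close>, to large \<open>n\<^sup>2 / R\<close>, and to the critical range in between,
  where \<open>\<kappa>\<close> bounds the smaller of the two exponents.\<close>

lemma expected_stable_le:
  fixes n :: nat and p L \<kappa> :: real
  assumes n: "n \<ge> 2" and L: "L = ln (real n)" and p: "0 < p" "p \<le> 1" "p \<le> L\<^sup>2 / real n"
    and \<kappa>: "0 \<le> \<kappa>" "p * real n \<le> \<kappa>\<^sup>2" and nL: "32 * L\<^sup>2 \<le> real n"
  shows "expected_stable n p \<le> (real n)\<^sup>2 * (exp 1 * real n *
           ((1 / 8) ^ n + exp (32 * L\<^sup>2 - real n * exp (- (L / 2))) + exp (8 * L - real n * exp (- \<kappa>))))"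
proof -
  let ?K = "PiE {..<n} (\<lambda>_. {..<n})"
  let ?g = "\<lambda>k. \<Prod>m<n. exp_factor p (\<Sum>i\<in>{..<n} - {m}. real (k i) / real (n - 1))"
  let ?A = "\<lambda>T. {k \<in> ?K. (\<Sum>m<n. k m) = T}"
  define E1 E2 E3 where "E1 = ((1 / 8) ^ n :: real)" and "E2 = exp (32 * L\<^sup>2 - real n * exp (- (L / 2)))"
    and "E3 = exp (8 * L - real n * exp (- \<kappa>))"
  define C where "C = exp 1 * real n * (E1 + E2 + E3)"
  have Lpos: "L > 0" using n by (simp add: L)
  have E: "0 \<le> E1" "0 \<le> E2" "0 \<le> E3" by (auto simp: E1_def E2_def E3_def)
  have fin: "finite ?K" by (intro finite_PiE) auto
  have bound: "fact n * ((\<Sum>k\<in>?A T. ?g k) / real n ^ n) \<le> C" for T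
  proof -
    define R where "R = real (T + n)"
    \<comment> \<open>The exponents in the bounds for \<open>exp_factor\<close> and for the number
      of rank vectors; their product does not depend on \<open>R\<close>.\<close>
    define a b where "a = p * R / real n" and "b = (real n)\<^sup>2 / R"
    have Rpos: "R > 0" using n by (simp add: R_def)
    have ab: "a > 0" "b > 0" "a * b = p * real n"
      using Rpos p n by (auto simp: a_def b_def power2_eq_square field_simps)
    have card: "real (card (?A T)) \<le> (exp 1 * R / real n) ^ n * (1 - exp (- b)) ^ n"
      unfolding b_def using n by (intro card_PiE_sum_eq_le) (auto simp: R_def)
    \<comment> \<open>\<open>B\<close> will be \<open>p\<close> for small \<open>R\<close> and
      \<open>n / R\<close> otherwise; the latter cancels the factor \<open>R / n\<close>.\<close>
    have combine: "fact n * ((\<Sum>k\<in>?A T. ?g k) / real n ^ n) \<le>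
        exp 1 * real n * ((R / real n * B) ^ n * (1 - exp (- b)) ^ n * D)"
      if g: "\<And>k. k \<in> ?A T \<Longrightarrow> ?g k \<le> B ^ n * D" and B: "0 \<le> B" "0 \<le> D" for B D
    proof -
      have "(\<Sum>k\<in>?A T. ?g k) \<le> real (card (?A T)) * (B ^ n * D)"
        using g by (rule sum_bounded_above)
      also have "\<dots> \<le> (exp 1 * R / real n) ^ n * (1 - exp (- b)) ^ n * (B ^ n * D)"
        using card B by (intro mult_right_mono) auto
      finally have "fact n * ((\<Sum>k\<in>?A T. ?g k) / real n ^ n) \<le>
          fact n * ((exp 1 * R / real n) ^ n * (1 - exp (- b)) ^ n * (B ^ n * D) / real n ^ n)"
        by (intro mult_left_mono divide_right_mono) auto
      also have "\<dots> = (fact n * (exp 1 / real n) ^ n) * ((R / real n * B) ^ n * (1 - exp (- b)) ^ n * D)"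
        by (simp add: power_mult_distrib power_divide mult_ac)
      also have "\<dots> \<le> (exp 1 * real n) * ((R / real n * B) ^ n * (1 - exp (- b)) ^ n * D)"
        using n Rpos B ab by (intro mult_right_mono fact_mult_exp_le mult_nonneg_nonneg) auto
      finally show ?thesis by simp
    qed
    show ?thesis
    \<comment> \<open>Below the threshold the trivial bound \<open>p\<close> for
      \<open>exp_factor\<close> already gives \<open>p * R / n \<le> 1 / 8\<close>. Above it
      \<open>b\<close> is at most \<open>8 * L\<^sup>2\<close>, which controls the loss
      \<open>exp (4 * b)\<close>.\<close>
    proof (cases "R \<le> (real n)\<^sup>2 / (8 * L\<^sup>2)")
      case True
      have "?g k \<le> p ^ n * 1" for k
      proof -
        have "?g k \<le> (\<Prod>m<n. p)"
          using p by (intro prod_mono) (auto intro!: exp_factor_le exp_factor_nonneg sum_nonneg)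
        then show ?thesis by simp
      qed
      then have "fact n * ((\<Sum>k\<in>?A T. ?g k) / real n ^ n) \<le>
          exp 1 * real n * ((R / real n * p) ^ n * (1 - exp (- b)) ^ n * 1)"
        using p by (intro combine) auto
      also have "\<dots> \<le> exp 1 * real n * ((1 / 8) ^ n * 1 * 1)"
      proof (intro mult_left_mono mult_mono power_mono)
        have "R / real n * p \<le> ((real n)\<^sup>2 / (8 * L\<^sup>2)) / real n * (L\<^sup>2 / real n)"
          using True p Rpos by (intro mult_mono divide_right_mono) auto
        also have "\<dots> = 1 / 8" using n Lpos by (simp add: power2_eq_square)
        finally show "R / real n * p \<le> 1 / 8" .
        show "(1 - exp (- b)) ^ n \<le> 1" using ab by (intro power_le_one) auto
      qed (use Rpos p ab in auto)
      also have "\<dots> \<le> C" unfolding C_def E1_def[symmetric] using E by (intro mult_left_mono) auto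
      finally show ?thesis .
    next
      case False
      have R4: "R / real n \<ge> 4"
      proof -
        have "4 * real n \<le> (real n)\<^sup>2 / (8 * L\<^sup>2)"
          using nL Lpos n by (simp add: field_simps power2_eq_square)
        with False show ?thesis using n by (simp add: field_simps)
      qed
      have b8: "b \<le> 8 * L\<^sup>2"
        using False Rpos Lpos n by (simp add: b_def field_simps)
      let ?D = "exp (4 * b) * (1 - exp (- a)) ^ n"
      have g: "?g k \<le> (real n / R) ^ n * ?D" if "k \<in> ?A T" for k
        using prod_exp_factor_le[OF n p(1), of k T R] that R4 by (simp add: R_def a_def b_def mult.assoc)
      have "fact n * ((\<Sum>k\<in>?A T. ?g k) / real n ^ n) \<le>
          exp 1 * real n * ((R / real n * (real n / R)) ^ n * (1 - exp (- b)) ^ n * ?D)"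
        using Rpos ab by (intro combine g) auto
      also have "\<dots> = exp 1 * real n * ((1 - exp (- b)) ^ n * ?D)"
        using Rpos n by simp
      also have "\<dots> \<le> exp 1 * real n * (exp (- (real n * exp (- b))) * (exp (4 * b) * exp (- (real n * exp (- a)))))"
        using ab by (intro mult_left_mono mult_mono one_minus_power_le_exp) auto
      also have "\<dots> = exp 1 * real n * exp (4 * b - real n * exp (- a) - real n * exp (- b))"
        by (simp add: mult_exp_exp algebra_simps)
      also have "\<dots> \<le> exp 1 * real n * (E2 + E3)"
      \<comment> \<open>For large \<open>b\<close> the product \<open>a * b \<le> L\<^sup>2\<close>
        forces \<open>a \<le> L / 2\<close>, and \<open>n * exp (- (L / 2))\<close>, the root of
        \<open>n\<close>, can absorb a loss of \<open>32 * L\<^sup>2\<close>. Otherwise the loss in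
        the exponent is only \<open>8 * L\<close>.\<close>
      proof (cases "b > 2 * L")
        case True
        have "p * real n \<le> L\<^sup>2" using p n by (simp add: field_simps)
        then have "a * b \<le> L\<^sup>2" using ab by simp
        have "a \<le> L / 2"
        proof (rule ccontr)
          assume "\<not> a \<le> L / 2"
          then have "(L / 2) * (2 * L) < a * b" using True Lpos by (intro mult_strict_mono) auto
          with \<open>a * b \<le> L\<^sup>2\<close> show False by (simp add: power2_eq_square)
        qed
        then have "real n * exp (- (L / 2)) \<le> real n * exp (- a)" by (intro mult_left_mono) auto
        then have "4 * b - real n * exp (- a) - real n * exp (- b) \<le> 32 * L\<^sup>2 - real n * exp (- (L / 2))"
          using b8 by (smt (verit) exp_gt_zero mult_nonneg_nonneg of_nat_0_le_iff)
        then show ?thesis using E unfolding E2_def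
          by (intro mult_left_mono) (auto intro: add_increasing2)
      next
        case False
        have "a \<le> \<kappa> \<or> b \<le> \<kappa>"
        proof (rule ccontr)
          assume "\<not> (a \<le> \<kappa> \<or> b \<le> \<kappa>)"
          then have "\<kappa> * \<kappa> < a * b" using \<kappa> by (intro mult_strict_mono) auto
          with \<kappa> ab show False by (simp add: power2_eq_square)
        qed
        then have "real n * exp (- \<kappa>) \<le> real n * exp (- a) \<or> real n * exp (- \<kappa>) \<le> real n * exp (- b)"
          by (auto intro!: mult_left_mono)
        then have "4 * b - real n * exp (- a) - real n * exp (- b) \<le> 8 * L - real n * exp (- \<kappa>)"
          using False by (smt (verit) exp_gt_zero mult_nonneg_nonneg of_nat_0_le_iff)
        then show ?thesis using E unfolding E3_def
          by (intro mult_left_mono) (auto intro: add_increasing)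
      qed
      also have "\<dots> \<le> C" unfolding C_def using E by (intro mult_left_mono) auto
      finally show ?thesis .
    qed
  qed
  have "expected_stable n p \<le> (\<Sum>M | M permutes {..<n}. (\<Sum>k\<in>?K. ?g k) / real n ^ n)"
    using p unfolding expected_stable_eq[OF less_imp_le[OF p(1)] p(2)]
    by (intro sum_mono expectation_stable_le) auto
  also have "\<dots> = fact n * ((\<Sum>k\<in>?K. ?g k) / real n ^ n)"
    by (simp add: card_permutations)
  also have "(\<Sum>k\<in>?K. ?g k) = (\<Sum>T<n\<^sup>2. \<Sum>k\<in>?A T. ?g k)"
  proof (rule sum.group[symmetric])
    show "(\<lambda>k. \<Sum>m<n. k m) ` ?K \<subseteq> {..<n\<^sup>2}"
    proof (intro image_subsetI)
      fix k assume k: "k \<in> ?K"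
      have "0 \<in> {..<n}" using n by auto
      then have "{..<n} \<noteq> {}" by blast
      then have "(\<Sum>m<n. k m) < (\<Sum>m<n. n)"
        using PiE_mem[OF k] by (intro sum_strict_mono) auto
      then show "(\<Sum>m<n. k m) \<in> {..<n\<^sup>2}" by (simp add: power2_eq_square)
    qed
  qed (use fin in auto)
  also have "fact n * ((\<Sum>T<n\<^sup>2. \<Sum>k\<in>?A T. ?g k) / real n ^ n) =
      (\<Sum>T<n\<^sup>2. fact n * ((\<Sum>k\<in>?A T. ?g k) / real n ^ n))"
    by (simp add: sum_distrib_left sum_divide_distrib)
  also have "\<dots> \<le> real (card {..<n\<^sup>2}) * C" using bound by (intro sum_bounded_above) auto
  finally show ?thesis by (simp add: C_def E1_def E2_def E3_def)
qed

section \<open>Lower bound\<close>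

text \<open>For \<open>c = - ln (1 - p)\<close> this is the logarithm of
  \<open>receive_factor\<close> as a function of \<open>e = d + 1\<close>. Nonnegativity of its
  second derivative is \<open>y \<le> sinh y\<close> at \<open>y = c * e / 2\<close>.\<close>

lemma convex_on_ln_exp_quotient:
  fixes c :: real
  assumes c: "c > 0"
  shows "convex_on {0<..} (\<lambda>e. ln (1 - exp (- (c * e))) - ln e)"
proof (rule f''_ge0_imp_convex[where
    f' = "\<lambda>e. c / (exp (c * e) - 1) - 1 / e" and
    f'' = "\<lambda>e. 1 / e\<^sup>2 - c\<^sup>2 * exp (c * e) / (exp (c * e) - 1)\<^sup>2"], goal_cases)
  case 1
  show ?case by simp
next
  case (2 x)
  then have x: "c * x > 0" "x > 0" using c by auto
  have eq: "c * exp (- (c * x)) / (1 - exp (- (c * x))) = c / (exp (c * x) - 1)"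
    using x c by (simp add: exp_minus field_simps)
  have "((\<lambda>e. ln (1 - exp (- (c * e))) - ln e) has_real_derivative
      (c * exp (- (c * x)) / (1 - exp (- (c * x))) - 1 / x)) (at x)"
    using x c by (auto intro!: derivative_eq_intros simp: field_simps)
  then show ?case unfolding eq .
next
  case (3 x)
  then have x: "c * x > 0" "x > 0" using c by auto
  then have "exp (c * x) - 1 \<noteq> 0" using c by simp
  then have "((\<lambda>e. c / (exp (c * e) - 1) - 1 / e) has_real_derivative
      (- (c * (exp (c * x) * c)) / ((exp (c * x) - 1) * (exp (c * x) - 1)) - (- 1 / (x * x)))) (at x)"
    using x by (auto intro!: derivative_eq_intros)
  then show ?case by (simp add: power2_eq_square mult_ac)
next
  case (4 x)
  then have x: "x > 0" "c * x > 0" using c by auto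
  define y where "y = c * x / 2"
  have y: "y > 0" using x by (simp add: y_def)
  have "y \<le> (exp y - inverse (exp y)) / 2"
    using y by (intro real_le_x_sinh) auto
  then have "c * x \<le> exp y - inverse (exp y)" by (simp add: y_def)
  then have "c * x * exp y \<le> (exp y - inverse (exp y)) * exp y" by (intro mult_right_mono) auto
  also have "\<dots> = exp (c * x) - 1" by (simp add: left_diff_distrib mult_exp_exp y_def)
  finally have "(c * x * exp y)\<^sup>2 \<le> (exp (c * x) - 1)\<^sup>2"
    using x by (intro power_mono) auto
  moreover have "(exp y)\<^sup>2 = exp (c * x)"
    by (simp add: power2_eq_square mult_exp_exp y_def)
  ultimately have "c\<^sup>2 * exp (c * x) * x\<^sup>2 \<le> (exp (c * x) - 1)\<^sup>2"
    by (simp add: power_mult_distrib mult_ac)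
  moreover have "(exp (c * x) - 1)\<^sup>2 > 0" using x c by simp
  ultimately show ?case using x c by (simp add: divide_simps)
qed

text \<open>Jensen's inequality with weights \<open>1 / n\<close> replaces every
  \<open>d w + 1\<close> by the mean \<open>R / n\<close>, so the bound depends on the total
  alone.\<close>

lemma prod_receive_factor_ge:
  fixes d :: "nat \<Rightarrow> nat"
  assumes n: "n > 0" and p: "0 < p" "p < 1" and R: "R = real ((\<Sum>w<n. d w) + n)"
  shows "(\<Prod>w<n. receive_factor p (d w)) \<ge> (real n / R * (1 - exp (- (p * R / real n)))) ^ n"
proof -
  define c where "c = - ln (1 - p)"
  define h where "h e = ln (1 - exp (- (c * e))) - ln e" for e :: real
  have c: "c > 0" "c \<ge> p" using p ln_le_minus_one[of "1 - p"] by (auto simp: c_def)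
  have Rpos: "R > 0" unfolding R using n by (intro of_nat_0_less_iff[THEN iffD2]) simp
  have exp_h: "exp (h e) = (1 - exp (- (c * e))) / e" if "e > 0" for e
    using that c by (simp add: h_def exp_diff)
  have rf: "receive_factor p k = exp (h (real (k + 1)))" for k
  proof -
    have "exp (- (c * real (k + 1))) = exp (ln (1 - p)) ^ (k + 1)"
      unfolding exp_of_nat_mult[symmetric] by (simp add: c_def mult.commute)
    then have "exp (- (c * real (k + 1))) = (1 - p) ^ (k + 1)" using p by simp
    then show ?thesis by (subst exp_h) (auto simp: receive_factor_def)
  qed
  have "h (\<Sum>w<n. (1 / real n) *\<^sub>R real (d w + 1)) \<le> (\<Sum>w<n. 1 / real n * h (real (d w + 1)))"
    unfolding h_def using n
    by (intro convex_on_sum[OF _ _ convex_on_ln_exp_quotient[OF c(1)]]) auto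
  moreover have "(\<Sum>w<n. (1 / real n) *\<^sub>R real (d w + 1)) = R / real n"
    by (simp add: R sum_divide_distrib[symmetric] sum.distrib)
  ultimately have "real n * h (R / real n) \<le> (\<Sum>w<n. h (real (d w + 1)))"
    using n by (simp add: sum_divide_distrib[symmetric] field_simps)
  then have "exp (h (R / real n)) ^ n \<le> (\<Prod>w<n. receive_factor p (d w))"
    unfolding rf by (simp add: exp_sum[symmetric] exp_of_nat_mult[symmetric])
  moreover have "(real n / R * (1 - exp (- (p * R / real n)))) ^ n \<le> exp (h (R / real n)) ^ n"
  proof (rule power_mono)
    \<comment> \<open>Passing from \<open>c\<close> to the smaller \<open>p\<close> only lowers the
      bound.\<close>
    have "p * (R / real n) \<le> c * (R / real n)" using c Rpos by (intro mult_right_mono) auto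
    then have "1 - exp (- (p * R / real n)) \<le> 1 - exp (- (c * (R / real n)))" by simp
    then have "real n / R * (1 - exp (- (p * R / real n))) \<le> real n / R * (1 - exp (- (c * (R / real n))))"
      using Rpos by (intro mult_left_mono) auto
    also have "\<dots> = exp (h (R / real n))" using Rpos n by (subst exp_h) auto
    finally show "real n / R * (1 - exp (- (p * R / real n))) \<le> exp (h (R / real n))" .
  qed (use p Rpos in auto)
  ultimately show ?thesis by linarith
qed

section \<open>Distribution of the total rank\<close>

text \<open>Double counting of the pairs of a man and a woman ahead of his partner in his list; it
  turns numbers of suitors into ranks of wives.\<close>

lemma sum_card_suitors:
  "(\<Sum>w<n. card (suitors n mp M w)) = (\<Sum>m<n. card (before (mp m) (M m) \<inter> {..<n}))"
proof -
  have "(\<Sum>w<n. card (suitors n mp M w)) = (\<Sum>w<n. \<Sum>m<n. of_bool (w \<in> before (mp m) (M m)))"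
    by (simp add: suitors_def Int_def)
  also have "\<dots> = (\<Sum>m<n. \<Sum>w<n. of_bool (w \<in> before (mp m) (M m)))"
    by (rule sum.swap)
  also have "\<dots> = (\<Sum>m<n. card (before (mp m) (M m) \<inter> {..<n}))"
    by (simp add: Int_def conj_commute)
  finally show ?thesis .
qed

text \<open>The vector of ranks minus one is uniform on the function space: the men's lists are
  independent, and each rank is uniform by \<open>expectation_card_before\<close>.\<close>

lemma expectation_sum_card_before:
  fixes H :: "nat \<Rightarrow> real"
  assumes M: "M permutes {..<n}"
  shows "measure_pmf.expectation (random_prefs n)
           (\<lambda>mp. H (\<Sum>m<n. card (before (mp m) (M m) \<inter> {..<n}))) =
         (\<Sum>k\<in>PiE {..<n} (\<lambda>_. {..<n}). H (\<Sum>m<n. k m)) / real n ^ n"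
proof -
  let ?K = "PiE {..<n} (\<lambda>_. {..<n})"
  let ?U = "pmf_of_set (permutations_of_set {..<n})"
  have fin: "finite ?K" by (intro finite_PiE) auto
  have M_lt: "M m < n" if "m < n" for m using permutes_in_image[OF M, of m] that by auto
  have "measure_pmf.expectation (random_prefs n)
           (\<lambda>mp. H (\<Sum>m<n. card (before (mp m) (M m) \<inter> {..<n}))) =
        measure_pmf.expectation (random_prefs n)
           (\<lambda>mp. \<Sum>k\<in>?K. H (\<Sum>m<n. k m) * (\<Prod>m<n. of_bool (card (before (mp m) (M m)) = k m)))"
  proof (rule integral_cong_AE)
    show "AE mp in random_prefs n. H (\<Sum>m<n. card (before (mp m) (M m) \<inter> {..<n})) =
        (\<Sum>k\<in>?K. H (\<Sum>m<n. k m) * (\<Prod>m<n. of_bool (card (before (mp m) (M m)) = k m)))"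
    proof (rule AE_pmfI)
      fix mp assume mp: "mp \<in> set_pmf (random_prefs n)"
      \<comment> \<open>The restriction matches the value \<open>undefined\<close> that members of
        \<open>?K\<close> take outside \<open>{..<n}\<close>, so \<open>r\<close> is the only
        \<open>k\<close> whose product of indicators is 1.\<close>
      define r where "r = restrict (\<lambda>m. card (before (mp m) (M m))) {..<n}"
      have B: "before (mp m) (M m) \<subseteq> {..<n} - {M m}" if "m < n" for m
        using random_prefs_permutation[OF mp that] before_subset[of "mp m" "M m"]
          not_in_before_self[of "mp m" "M m"] by (auto simp: permutations_of_set_def)
      have "card (before (mp m) (M m)) < n" if "m < n" for m
      proof -
        have "card (before (mp m) (M m)) \<le> card ({..<n} - {M m})"
          using B[OF that] by (intro card_mono) auto
        then show ?thesis using M_lt[OF that] that by simp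
      qed
      then have rK: "r \<in> ?K" by (auto simp: r_def)
      have "(\<Sum>m<n. card (before (mp m) (M m) \<inter> {..<n})) = (\<Sum>m<n. r m)"
      proof (rule sum.cong, goal_cases)
        case (2 m)
        then have "before (mp m) (M m) \<inter> {..<n} = before (mp m) (M m)" using B[of m] by auto
        then show ?case using 2 by (simp add: r_def)
      qed simp
      moreover have "(\<Prod>m<n. of_bool (card (before (mp m) (M m)) = k m)) = (if k = r then 1 else 0 :: real)"
        if k: "k \<in> ?K" for k
      proof (cases "k = r")
        case True
        then show ?thesis by (simp add: r_def)
      next
        case False
        then obtain m where "m < n" "k m \<noteq> r m" using PiE_ext[OF k rK] by blast
        then have "\<exists>m\<in>{..<n}. of_bool (card (before (mp m) (M m)) = k m) = (0 :: real)"
          by (intro bexI[of _ m]) (auto simp: r_def)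
        then show ?thesis using False by simp
      qed
      ultimately show "H (\<Sum>m<n. card (before (mp m) (M m) \<inter> {..<n})) =
        (\<Sum>k\<in>?K. H (\<Sum>m<n. k m) * (\<Prod>m<n. of_bool (card (before (mp m) (M m)) = k m)))"
        using rK fin by (simp add: if_distrib[of "\<lambda>x. _ * x"] cong: if_cong sum.cong)
    qed
  qed auto
  also have "\<dots> = (\<Sum>k\<in>?K. H (\<Sum>m<n. k m) * measure_pmf.expectation (random_prefs n)
        (\<lambda>mp. \<Prod>m<n. of_bool (card (before (mp m) (M m)) = k m)))"
    by (subst Bochner_Integration.integral_sum)
       (auto intro!: integrable_measure_pmf_finite finite_set_random_prefs)
  also have "\<dots> = (\<Sum>k\<in>?K. H (\<Sum>m<n. k m) * (1 / real n ^ n))"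
  proof (rule sum.cong, goal_cases)
    case (2 k)
    have "measure_pmf.expectation (random_prefs n)
        (\<lambda>mp. \<Prod>m<n. of_bool (card (before (mp m) (M m)) = k m)) =
      (\<Prod>m<n. measure_pmf.expectation ?U (\<lambda>xs. of_bool (card (before xs (M m)) = k m) :: real))"
      unfolding random_prefs_def
      by (intro expectation_prod_Pi_pmf) (auto intro!: integrable_measure_pmf_finite)
    also have "\<dots> = (\<Prod>m<n. 1 / real n)"
    proof (rule prod.cong, goal_cases)
      case (2 m)
      then show ?case
        using expectation_card_before[of "{..<n}" "M m" "k m"] M_lt \<open>k \<in> ?K\<close>
        by (auto simp: PiE_def Pi_def)
    qed simp
    finally show ?case by (simp add: power_one_over)
  qed simp
  finally show ?thesis by (simp add: sum_divide_distrib)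
qed

text \<open>The bound of \<open>prod_receive_factor_ge\<close> sees the lists only through the total
  rank, so its expectation is the same for each of the \<open>fact n\<close> matchings.\<close>

lemma expected_stable_ge_sum:
  assumes n: "n > 0" and p: "0 < p" "p < 1"
  shows "expected_stable n p \<ge> fact n *
      ((\<Sum>k\<in>PiE {..<n} (\<lambda>_. {..<n}). (real n / real ((\<Sum>m<n. k m) + n) *
          (1 - exp (- (p * real ((\<Sum>m<n. k m) + n) / real n)))) ^ n) / real n ^ n)"
proof -
  let ?K = "PiE {..<n} (\<lambda>_. {..<n})"
  define H where "H T = (real n / real (T + n) * (1 - exp (- (p * real (T + n) / real n)))) ^ n" for T
  have "(\<Sum>k\<in>?K. H (\<Sum>m<n. k m)) / real n ^ n \<le> measure_pmf.expectation (random_prefs n)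
           (\<lambda>mp. \<Prod>w<n. receive_factor p (card (suitors n mp M w)))"
    if M: "M permutes {..<n}" for M
    unfolding expectation_sum_card_before[OF M, symmetric]
  proof (rule integral_mono)
    fix mp
    show "H (\<Sum>m<n. card (before (mp m) (M m) \<inter> {..<n})) \<le> (\<Prod>w<n. receive_factor p (card (suitors n mp M w)))"
      unfolding H_def sum_card_suitors[symmetric] using n p by (intro prod_receive_factor_ge) auto
  qed (auto intro!: integrable_measure_pmf_finite finite_set_random_prefs)
  then have "(\<Sum>M | M permutes {..<n}. (\<Sum>k\<in>?K. H (\<Sum>m<n. k m)) / real n ^ n) \<le> expected_stable n p"
    using p by (subst expected_stable_eq) (auto intro!: sum_mono simp del: sum_constant)
  then show ?thesis by (simp add: card_permutations H_def)
qed

section \<open>Lower bounds for the number of rank vectors\<close>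

text \<open>A union bound over the coordinate that is \<open>n\<close> or more. Lowering it by
  \<open>n\<close> is injective and leaves a vector with sum \<open>T - n\<close>; stars and bars
  counts \<open>T - 1 choose (n - 1)\<close> of these.\<close>

lemma card_PiE_sum_eq_ge:
  fixes n T :: nat
  assumes n: "n > 0" and T: "n \<le> T"
  shows "real (card {k \<in> PiE {..<n} (\<lambda>_. {..<n}). (\<Sum>m<n. k m) = T}) \<ge>
         real (T + n - 1 choose (n - 1)) - real n * real (T - 1 choose (n - 1))"
proof -
  define Ls where "Ls T = {l :: nat list. length l = n \<and> sum_list l = T}" for T
  define B where "B i = {l \<in> Ls T. l ! i \<ge> n}" for i
  let ?A = "{k \<in> PiE {..<n} (\<lambda>_. {..<n}). (\<Sum>m<n. k m) = T}"
  let ?G = "Ls T - (\<Union>i<n. B i)"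
  have card_Ls: "card (Ls T) = T + n - 1 choose (n - 1)" for T
    unfolding Ls_def card_length_sum_list using n
    by (subst binomial_symmetric) auto
  have fin: "finite (Ls T)" for T
  proof (rule finite_subset)
    show "Ls T \<subseteq> {l. set l \<subseteq> {..T} \<and> length l = n}"
      by (auto simp: Ls_def intro: member_le_sum_list)
  qed (simp add: finite_lists_length_eq)
  have finA: "finite ?A" by (auto intro!: finite_PiE)
  have "card (B i) \<le> card (Ls (T - n))" if i: "i < n" for i
  proof (rule card_inj_on_le[of "\<lambda>l. l[i := l ! i - n]"])
    show "inj_on (\<lambda>l. l[i := l ! i - n]) (B i)"
    proof (rule inj_onI)
      fix l l' assume l: "l \<in> B i" "l' \<in> B i" and eq: "l[i := l ! i - n] = l'[i := l' ! i - n]"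
      have "l ! j = l' ! j" if "j < n" for j
      proof (cases "j = i")
        case True
        have "l ! i - n = l' ! i - n"
          using arg_cong[OF eq, of "\<lambda>l. l ! i"] l i by (simp add: B_def Ls_def)
        then show ?thesis using l True by (simp add: B_def eq_diff_iff)
      next
        case False
        then show ?thesis
          using arg_cong[OF eq, of "\<lambda>l. l ! j"] l by (simp add: B_def Ls_def)
      qed
      then show "l = l'" using l by (intro nth_equalityI) (auto simp: B_def Ls_def)
    qed
    show "(\<lambda>l. l[i := l ! i - n]) ` B i \<subseteq> Ls (T - n)"
    proof (intro image_subsetI)
      fix l assume l: "l \<in> B i"
      then have "l ! i \<le> sum_list l" using i by (intro member_le_sum_list) (auto simp: B_def Ls_def)
      then show "l[i := l ! i - n] \<in> Ls (T - n)"
        using l i by (simp add: B_def Ls_def sum_list_update)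
    qed
  qed (rule fin)
  then have "card (\<Union>i<n. B i) \<le> (\<Sum>i<n. card (Ls (T - n)))"
    by (intro order.trans[OF card_UN_le] sum_mono) auto
  then have "card (\<Union>i<n. B i) \<le> n * (T - 1 choose (n - 1))"
    using T n by (simp add: card_Ls)
  then have "real (card (\<Union>i<n. B i)) \<le> real n * real (T - 1 choose (n - 1))"
    by (metis of_nat_le_iff of_nat_mult)
  moreover have "card (Ls T) \<le> card ?G + card (\<Union>i<n. B i)"
  proof -
    have "(\<Union>i<n. B i) \<subseteq> Ls T" by (auto simp: B_def)
    then have "Ls T = ?G \<union> (\<Union>i<n. B i)" by blast
    then show ?thesis by (metis card_Un_le)
  qed
  moreover have "card ?G \<le> card ?A"
  proof (rule card_inj_on_le[of "\<lambda>l. restrict (\<lambda>m. l ! m) {..<n}"])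
    show "inj_on (\<lambda>l. restrict (\<lambda>m. l ! m) {..<n}) ?G"
    proof (rule inj_onI)
      fix l l' assume l: "l \<in> ?G" "l' \<in> ?G"
        and eq: "restrict (\<lambda>m. l ! m) {..<n} = restrict (\<lambda>m. l' ! m) {..<n}"
      have "l ! j = l' ! j" if "j < n" for j
        using fun_cong[OF eq, of j] that by simp
      then show "l = l'" using l by (intro nth_equalityI) (auto simp: Ls_def)
    qed
    show "(\<lambda>l. restrict (\<lambda>m. l ! m) {..<n}) ` ?G \<subseteq> ?A"
    proof (intro image_subsetI)
      fix l assume l: "l \<in> ?G"
      then have "l ! m < n" if "m < n" for m using that by (auto simp: B_def not_le)
      moreover have "(\<Sum>m<n. l ! m) = T"
        using l by (auto simp: Ls_def sum_list_sum_nth atLeast0LessThan)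
      ultimately show "restrict (\<lambda>m. l ! m) {..<n} \<in> ?A" by simp
    qed
  qed (rule finA)
  ultimately show ?thesis
    using card_Ls[of T] by linarith
qed

text \<open>Pairing the factors \<open>i\<close> and \<open>n - 2 - i\<close> saves a factor of about \<open>exp (n\<^sup>2 / (2 R))\<close>, of order
  \<open>sqrt n\<close>, over bounding each factor by \<open>R - n\<close>; the lower bound would not diverge without it.\<close>

lemma prod_diff_ge:
  fixes R :: real
  assumes n: "n > 0" and R: "R \<ge> 2 * real n"
  shows "(\<Prod>i<n - 1. R - 1 - real i) \<ge>
         R ^ (n - 1) * exp (- ((real n)\<^sup>2 / R / 2 + ((real n)\<^sup>2 / R)\<^sup>2 / real n))"
proof -
  let ?X = "\<Prod>i<n - 1. R - 1 - real i"
  define x b where "x = real n / R" and "b = (real n)\<^sup>2 / R"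
  have Rpos: "R > 0" and x: "0 < x" "x \<le> 1 / 2" using n R by (auto simp: x_def field_simps)
  have b: "b = real n * x" by (simp add: b_def x_def power2_eq_square)
  have rev: "?X = (\<Prod>i<n - 1. R - real n + 1 + real i)"
  proof (rule prod.reindex_bij_witness[of _ "\<lambda>i. n - 2 - i" "\<lambda>i. n - 2 - i"], goal_cases)
    case (5 i)
    then have "real (n - 2 - i) = real n - 2 - real i" by auto
    then show ?case by simp
  qed auto
  have "(R\<^sup>2 * exp (- x - 2 * x\<^sup>2)) ^ (n - 1) \<le> (R * (R - real n)) ^ (n - 1)"
  proof (rule power_mono)
    \<comment> \<open>The two terms in this exponent, times \<open>n / 2\<close>, are the two terms
      in the exponent of the claim.\<close>
    have "exp (- x - 2 * x\<^sup>2) \<le> 1 - x"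
      using ln_one_minus_pos_lower_bound[of x] x by (subst ln_ge_iff[symmetric]) auto
    then have "R\<^sup>2 * exp (- x - 2 * x\<^sup>2) \<le> R\<^sup>2 * (1 - x)"
      using x by (intro mult_left_mono) auto
    also have "\<dots> = R * (R - real n)" using Rpos by (simp add: x_def power2_eq_square field_simps)
    finally show "R\<^sup>2 * exp (- x - 2 * x\<^sup>2) \<le> R * (R - real n)" .
  qed simp
  also have "\<dots> = (\<Prod>i<n - 1. R * (R - real n))" by simp
  also have "\<dots> \<le> (\<Prod>i<n - 1. (R - 1 - real i) * (R - real n + 1 + real i))"
  proof (rule prod_mono, goal_cases)
    case (1 i)
    then have i: "real i + 1 \<le> real n - 1" "i < n - 1" by auto
    have "(R - 1 - real i) * (R - real n + 1 + real i) = R * (R - real n) + (real i + 1) * (real n - 1 - real i)"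
      by (simp add: algebra_simps)
    moreover have "0 \<le> (real i + 1) * (real n - 1 - real i)" using i by (intro mult_nonneg_nonneg) auto
    ultimately show ?case using R Rpos by auto
  qed
  also have "\<dots> = ?X\<^sup>2" unfolding power2_eq_square by (subst (2) rev) (simp add: prod.distrib)
  finally have 1: "(R\<^sup>2 * exp (- x - 2 * x\<^sup>2)) ^ (n - 1) \<le> ?X\<^sup>2" .
  have "(R ^ (n - 1) * exp (- (b / 2 + b\<^sup>2 / real n)))\<^sup>2 = (R\<^sup>2) ^ (n - 1) * exp (- (real n * (x + 2 * x\<^sup>2)))"
  proof -
    have "(exp (- (b / 2 + b\<^sup>2 / real n)))\<^sup>2 = exp (2 * (- (b / 2 + b\<^sup>2 / real n)))"
      by (simp only: exp_double)
    also have "2 * (- (b / 2 + b\<^sup>2 / real n)) = - (real n * (x + 2 * x\<^sup>2))"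
      using n by (simp add: b power2_eq_square algebra_simps)
    finally show ?thesis by (simp only: power_mult_distrib power_mult[symmetric] mult.commute[of 2])
  qed
  also have "\<dots> \<le> (R\<^sup>2) ^ (n - 1) * exp (- (real (n - 1) * (x + 2 * x\<^sup>2)))"
  proof -
    have "real (n - 1) * (x + 2 * x\<^sup>2) \<le> real n * (x + 2 * x\<^sup>2)"
      using x by (intro mult_right_mono) auto
    then show ?thesis using Rpos by (intro mult_left_mono) auto
  qed
  also have "\<dots> = (R\<^sup>2 * exp (- x - 2 * x\<^sup>2)) ^ (n - 1)"
  proof -
    have "exp (- x - 2 * x\<^sup>2) ^ (n - 1) = exp (real (n - 1) * (- x - 2 * x\<^sup>2))"
      by (rule exp_of_nat_mult[symmetric])
    also have "real (n - 1) * (- x - 2 * x\<^sup>2) = - (real (n - 1) * (x + 2 * x\<^sup>2))"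
      by (simp only: distrib_left right_diff_distrib)
    finally show ?thesis by (simp only: power_mult_distrib)
  qed
  finally have "(R ^ (n - 1) * exp (- (b / 2 + b\<^sup>2 / real n)))\<^sup>2 \<le> ?X\<^sup>2" using 1 by linarith
  moreover have "0 \<le> ?X" using R n by (intro prod_nonneg) auto
  ultimately have "R ^ (n - 1) * exp (- (b / 2 + b\<^sup>2 / real n)) \<le> ?X"
    by (rule power2_le_imp_le)
  then show ?thesis by (simp add: b_def)
qed

text \<open>The subtracted term of \<open>card_PiE_sum_eq_ge\<close> is at most half of the main
  one: factor by factor the ratio of the two binomials is at most \<open>1 - x\<close>, and the
  lower bound on \<open>b\<close> makes \<open>n * (1 - x) ^ (n - 1)\<close> small.\<close>

lemma card_PiE_sum_eq_ge_exp:
  fixes n T :: nat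
  assumes n: "n > 0" and R: "R = real (T + n)" "R \<ge> 2 * real n"
    and b: "b = (real n)\<^sup>2 / R" "b \<ge> ln (real n) + 2"
  shows "real (card {k \<in> PiE {..<n} (\<lambda>_. {..<n}). (\<Sum>m<n. k m) = T}) \<ge>
         R ^ (n - 1) * exp (- (b / 2 + b\<^sup>2 / real n)) / (2 * fact (n - 1))"
proof -
  let ?X = "\<Prod>i<n - 1. R - 1 - real i" and ?Y = "\<Prod>i<n - 1. R - real n - 1 - real i"
  define x where "x = real n / R"
  have Rpos: "R > 0" and x: "0 < x" "x \<le> 1 / 2" using n R(2) by (auto simp: x_def field_simps)
  have Tn: "T \<ge> n" using R by simp
  have X: "real (T + n - 1 choose (n - 1)) = ?X / fact (n - 1)"
    using n by (simp add: binomial_gbinomial gbinomial_prod_rev R(1) atLeast0LessThan)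
  have Y: "real (T - 1 choose (n - 1)) = ?Y / fact (n - 1)"
    using n Tn by (simp add: binomial_gbinomial gbinomial_prod_rev R(1) atLeast0LessThan)
  have X0: "0 \<le> ?X" using R(2) n by (intro prod_nonneg) auto
  have "?Y \<le> (\<Prod>i<n - 1. (1 - x) * (R - 1 - real i))"
  proof (rule prod_mono, goal_cases)
    case (1 i)
    then have i: "real i + 1 \<le> real n - 1" "i < n - 1" by auto
    have "(1 - x) * (R - 1 - real i) = R - real n - 1 - real i + x * (1 + real i)"
      using Rpos by (simp add: x_def field_simps)
    then show ?case using i R(2) x by auto
  qed
  also have "\<dots> = (1 - x) ^ (n - 1) * ?X" by (simp add: prod.distrib)
  finally have YX: "?Y \<le> (1 - x) ^ (n - 1) * ?X" .
  have "real n * (1 - x) ^ (n - 1) \<le> real n * exp (- (real (n - 1) * x))"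
    using x by (intro mult_left_mono one_minus_power_le_exp) auto
  also have "\<dots> = exp (ln (real n) - real (n - 1) * x)"
    using n exp_add[of "ln (real n)" "- (real (n - 1) * x)"] by simp
  also have "\<dots> \<le> exp (- 1)"
  proof -
    \<comment> \<open>With \<open>b \<ge> ln n + 2\<close> and \<open>x \<le> 1 / 2\<close> the
      exponent is at most \<open>- 3 / 2\<close>.\<close>
    have "real (n - 1) * x = b - x" using n by (simp add: b(1) x_def power2_eq_square left_diff_distrib diff_divide_distrib)
    then show ?thesis using b(2) x by simp
  qed
  also have "\<dots> \<le> (1 / 2 :: real)"
    using exp_ge_add_one_self[of 1] by (simp add: exp_minus field_simps)
  finally have half: "real n * (1 - x) ^ (n - 1) \<le> 1 / 2" .
  have "real n * ?Y \<le> real n * ((1 - x) ^ (n - 1) * ?X)" using YX by (intro mult_left_mono) auto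
  also have "\<dots> \<le> 1 / 2 * ?X" unfolding mult.assoc[symmetric] using half X0 by (intro mult_right_mono) auto
  finally have "?X / 2 \<le> ?X - real n * ?Y" by simp
  then have "?X / 2 / fact (n - 1) \<le> (?X - real n * ?Y) / fact (n - 1)"
    by (intro divide_right_mono) auto
  also have "\<dots> = real (T + n - 1 choose (n - 1)) - real n * real (T - 1 choose (n - 1))"
    unfolding X Y by (simp add: diff_divide_distrib)
  also have "\<dots> \<le> real (card {k \<in> PiE {..<n} (\<lambda>_. {..<n}). (\<Sum>m<n. k m) = T})"
    using n Tn by (rule card_PiE_sum_eq_ge)
  finally have "?X / 2 / fact (n - 1) \<le> real (card {k \<in> PiE {..<n} (\<lambda>_. {..<n}). (\<Sum>m<n. k m) = T})" .
  moreover have "R ^ (n - 1) * exp (- (b / 2 + b\<^sup>2 / real n)) / 2 / fact (n - 1) \<le> ?X / 2 / fact (n - 1)"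
    using prod_diff_ge[OF n R(2)] by (intro divide_right_mono) (auto simp: b)
  ultimately show ?thesis by simp
qed

section \<open>Lower bound from a window of total ranks\<close>

text \<open>Only total ranks \<open>R\<close> with \<open>n\<^sup>2 / R\<close> between
  \<open>L + 2\<close> and \<open>L + 3\<close> are kept. The first factor bounds their number from
  below, the second the contribution of each.\<close>

lemma expected_stable_ge:
  fixes n :: nat and p L :: real
  assumes n: "n \<ge> 2" and L: "L = ln (real n)" and p: "p < 1" "L\<^sup>2 / real n \<le> p"
    and large: "2 * (L + 3) \<le> real n" "exp 3 / real n \<le> 1" "L \<ge> 1"
  shows "expected_stable n p \<ge> ((real n)\<^sup>2 / (L + 2) - (real n)\<^sup>2 / (L + 3) - 1) *
     (1 / (2 * real n) * exp (- ((L + 3) / 2 + (L + 3)\<^sup>2 / real n)) * (1 - exp 3 / real n) ^ n)"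
proof -
  let ?K = "PiE {..<n} (\<lambda>_. {..<n})"
  define H where "H T = (real n / real (T + n) * (1 - exp (- (p * real (T + n) / real n)))) ^ n" for T
  define Z where "Z = 1 / (2 * real n) * exp (- ((L + 3) / 2 + (L + 3)\<^sup>2 / real n)) * (1 - exp 3 / real n) ^ n"
  define u v where "u = (real n)\<^sup>2 / (L + 3)" and "v = (real n)\<^sup>2 / (L + 2)"
  define W where "W = {nat \<lceil>u\<rceil>..nat \<lfloor>v\<rfloor>}"
  let ?A = "\<lambda>T. {k \<in> ?K. (\<Sum>m<n. k m) = T}"
  have fin: "finite ?K" by (intro finite_PiE) auto
  have p0: "0 < p"
  proof -
    have "0 < L\<^sup>2 / real n" using n large by simp
    then show ?thesis using p by linarith
  qed
  have H0: "0 \<le> H T" for T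
    unfolding H_def using p0 by (intro zero_le_power mult_nonneg_nonneg) auto
  have uv: "0 \<le> u" "0 \<le> v" "2 * real n \<le> u"
    using large n mult_left_mono[OF large(1), of "real n"]
    by (auto simp: u_def v_def pos_le_divide_eq power2_eq_square mult_ac)
  have W: "u \<le> real R" "real R \<le> v" if "R \<in> W" for R
    using that uv by (auto simp: W_def le_nat_floor le_nat_iff nat_le_iff ceiling_le_iff le_floor_iff)
  have Z0: "0 \<le> Z" using large n by (simp add: Z_def)
  have window: "Z \<le> fact n * (real (card (?A (R - n))) * H (R - n) / real n ^ n)" if R: "R \<in> W" for R
  proof -
    define r b where "r = real R" and "b = (real n)\<^sup>2 / r"
    have r: "u \<le> r" "r \<le> v" "r \<ge> 2 * real n" "r > 0" using W[OF R] uv n by (auto simp: r_def)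
    then have Rn: "R \<ge> n" by (simp add: r_def)
    have rT: "r = real (R - n + n)" using Rn by (simp add: r_def)
    have bL: "b \<ge> L + 2" "b \<le> L + 3"
      using r large n by (auto simp: b_def u_def v_def field_simps)
    have card: "real (card (?A (R - n))) \<ge> r ^ (n - 1) * exp (- (b / 2 + b\<^sup>2 / real n)) / (2 * fact (n - 1))"
      using n bL r rT by (intro card_PiE_sum_eq_ge_exp) (auto simp: b_def L)
    have exps: "exp (- ((L + 3) / 2 + (L + 3)\<^sup>2 / real n)) \<le> exp (- (b / 2 + b\<^sup>2 / real n))"
    proof -
      have "b / 2 + b\<^sup>2 / real n \<le> (L + 3) / 2 + (L + 3)\<^sup>2 / real n"
        using bL large by (intro add_mono divide_right_mono power_mono) auto
      then show ?thesis by simp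
    qed
    have "1 - exp 3 / real n \<le> 1 - exp (- (p * r / real n))"
    proof -
      \<comment> \<open>The window costs at most 3 in the exponent, as
        \<open>(L - 3) * (L + 3) \<le> L\<^sup>2\<close>. This is where the constant
        \<open>exp 3 / n\<close> comes from.\<close>
      have "L - 3 \<le> L\<^sup>2 / b"
      proof -
        have "(L - 3) * b \<le> L\<^sup>2"
        proof (cases "L \<ge> 3")
          case True
          then have "(L - 3) * b \<le> (L - 3) * (L + 3)" using bL by (intro mult_left_mono) auto
          also have "\<dots> \<le> L\<^sup>2" by (simp add: algebra_simps power2_eq_square)
          finally show ?thesis .
        next
          case False
          then have "(L - 3) * b \<le> 0" using bL large by (intro mult_nonpos_nonneg) auto
          then show ?thesis by (smt (verit) zero_le_power2)
        qed
        then show ?thesis using bL large by (simp add: pos_le_divide_eq)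
      qed
      also have "L\<^sup>2 / b = L\<^sup>2 / real n * r / real n" using n r by (simp add: b_def power2_eq_square)
      also have "\<dots> \<le> p * r / real n"
        using p r by (intro divide_right_mono mult_right_mono) auto
      finally have "exp (- (p * r / real n)) \<le> exp (3 - L)" by simp
      also have "\<dots> = exp 3 / real n" using n by (simp add: L exp_diff)
      finally show ?thesis by simp
    qed
    then have pw: "(1 - exp 3 / real n) ^ n \<le> (1 - exp (- (p * r / real n))) ^ n"
      using large by (intro power_mono) auto
    have H: "H (R - n) = (real n / r) ^ n * (1 - exp (- (p * r / real n))) ^ n"
      unfolding H_def rT[symmetric] by (rule power_mult_distrib)
    have "Z \<le> real n / (2 * r) * exp (- (b / 2 + b\<^sup>2 / real n)) * (1 - exp (- (p * r / real n))) ^ n"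
      unfolding Z_def
    proof (intro mult_mono exps pw)
      have "1 \<le> b" using bL large by simp
      then have "r \<le> (real n)\<^sup>2" using r by (simp add: b_def)
      then show "1 / (2 * real n) \<le> real n / (2 * r)"
        using r n by (simp add: field_simps power2_eq_square)
    qed (use large r p0 in auto)
    also have "\<dots> = fact n * ((r ^ (n - 1) * exp (- (b / 2 + b\<^sup>2 / real n)) / (2 * fact (n - 1))) * H (R - n) / real n ^ n)"
    proof -
      define a f N where "a = r ^ (n - 1)" and "f = (fact (n - 1) :: real)" and "N = real n ^ n"
      have pos: "a > 0" "f > 0" "N > 0" "r > 0" using r n by (auto simp: a_def f_def N_def)
      have eqs: "fact n = real n * f" "(real n / r) ^ n = N / (a * r)"
        unfolding f_def N_def a_def power_divide
        using n power_minus_mult[of n r] fact_reduce[of n, where ?'a = real] by simp_all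
      show ?thesis
        unfolding H eqs a_def[symmetric] f_def[symmetric] N_def[symmetric]
        using pos by (simp add: field_simps)
    qed
    also have "\<dots> \<le> fact n * (real (card (?A (R - n))) * H (R - n) / real n ^ n)"
    proof -
      have "0 \<le> H (R - n)" by (rule H0)
      then show ?thesis using card by (intro mult_left_mono divide_right_mono mult_right_mono) auto
    qed
    finally show ?thesis .
  qed
  \<comment> \<open>Truncated subtraction is injective here because every \<open>R\<close> in the
    window is at least \<open>n\<close>.\<close>
  have inj: "inj_on (\<lambda>R. R - n) W"
  proof (rule inj_onI)
    fix R R' assume "R \<in> W" "R' \<in> W" "R - n = R' - n"
    moreover have "real n \<le> real R" "real n \<le> real R'"
      using W(1)[OF \<open>R \<in> W\<close>] W(1)[OF \<open>R' \<in> W\<close>] uv by linarith+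
    ultimately show "R = R'" by simp
  qed
  have "(v - u - 1) * Z \<le> real (card W) * Z"
  proof (intro mult_right_mono Z0)
    have "real (nat \<lfloor>v\<rfloor>) \<ge> v - 1" "real (nat \<lceil>u\<rceil>) \<le> u + 1" using uv by linarith+
    then show "v - u - 1 \<le> real (card W)" unfolding W_def card_atLeastAtMost by linarith
  qed
  also have "\<dots> \<le> (\<Sum>R\<in>W. fact n * (real (card (?A (R - n))) * H (R - n) / real n ^ n))"
    using window by (rule sum_bounded_below)
  also have "\<dots> = (\<Sum>T\<in>(\<lambda>R. R - n) ` W. fact n * ((\<Sum>k\<in>?A T. H (\<Sum>m<n. k m)) / real n ^ n))"
    by (subst sum.reindex[OF inj]) simp
  also have "\<dots> = fact n * ((\<Sum>T\<in>(\<lambda>R. R - n) ` W. \<Sum>k\<in>?A T. H (\<Sum>m<n. k m)) / real n ^ n)"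
    by (simp only: sum_distrib_left sum_divide_distrib)
  also have "\<dots> \<le> fact n * ((\<Sum>k\<in>?K. H (\<Sum>m<n. k m)) / real n ^ n)"
  proof (intro mult_left_mono divide_right_mono)
    have "(\<Sum>T\<in>(\<lambda>R. R - n) ` W. \<Sum>k\<in>?A T. H (\<Sum>m<n. k m)) =
        (\<Sum>k\<in>(\<Union>T\<in>(\<lambda>R. R - n) ` W. ?A T). H (\<Sum>m<n. k m))"
    proof (rule sum.UNION_disjoint[symmetric])
      show "finite ((\<lambda>R. R - n) ` W)" by (simp add: W_def)
      show "\<forall>T\<in>(\<lambda>R. R - n) ` W. finite (?A T)" using fin by simp
      show "\<forall>T\<in>(\<lambda>R. R - n) ` W. \<forall>T'\<in>(\<lambda>R. R - n) ` W. T \<noteq> T' \<longrightarrow> ?A T \<inter> ?A T' = {}" by blast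
    qed
    also have "\<dots> \<le> (\<Sum>k\<in>?K. H (\<Sum>m<n. k m))"
    proof (rule sum_mono2[OF fin])
      show "(\<Union>T\<in>(\<lambda>R. R - n) ` W. ?A T) \<subseteq> ?K" by blast
      show "0 \<le> H (\<Sum>m<n. k m)" for k
        by (rule H0)
    qed
    finally show "(\<Sum>T\<in>(\<lambda>R. R - n) ` W. \<Sum>k\<in>?A T. H (\<Sum>m<n. k m)) \<le> (\<Sum>k\<in>?K. H (\<Sum>m<n. k m))" .
  qed auto
  also have "\<dots> \<le> expected_stable n p"
    using expected_stable_ge_sum[of n p] n p0 p(1) unfolding H_def by auto
  finally show ?thesis by (simp add: Z_def u_def v_def)
qed

section \<open>Asymptotics\<close>

lemma expected_stable_tendsto_zero:
  fixes p :: "nat \<Rightarrow> real" and \<alpha> :: real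
  assumes p_range: "\<And>n. 0 < p n \<and> p n < 1" and \<alpha>: "\<alpha> > 2"
    and p_le: "\<forall>\<^sub>F n in sequentially.
      p n \<le> (ln (real n))\<^sup>2 / real n * (1 - \<alpha> * (ln (ln (real n)) / ln (real n)))"
  shows "(\<lambda>n. expected_stable n (p n)) \<longlonglongrightarrow> 0"
proof -
  define \<beta> where "\<beta> = \<alpha> / 2"
  have \<beta>: "\<beta> > 1" using \<alpha> by (simp add: \<beta>_def)
  \<comment> \<open>\<open>n * exp (- \<kappa> n)\<close> is \<open>ln n\<close> to the power
    \<open>\<beta>\<close>; since \<open>\<beta> > 1\<close>, it outgrows \<open>8 * ln n\<close>
    together with the polynomial prefactor.\<close>
  define \<kappa> where "\<kappa> n = ln (real n) - \<beta> * ln (ln (real n))" for n :: nat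
  let ?U = "\<lambda>n. (real n)\<^sup>2 * (exp 1 * real n * ((1 / 8) ^ n +
      exp (32 * (ln (real n))\<^sup>2 - real n * exp (- (ln (real n) / 2))) +
      exp (8 * ln (real n) - real n * exp (- \<kappa> n))))"
  have lim: "?U \<longlonglongrightarrow> 0"
    unfolding \<kappa>_def using \<beta> by real_asymp
  have "\<forall>\<^sub>F n in sequentially. 0 \<le> \<kappa> n"
    unfolding \<kappa>_def by real_asymp
  moreover have "\<forall>\<^sub>F n in sequentially. 32 * (ln (real n))\<^sup>2 \<le> real n" by real_asymp
  moreover have "\<forall>\<^sub>F n in sequentially. 1 \<le> ln (real n)" by real_asymp
  ultimately have le: "\<forall>\<^sub>F n in sequentially. expected_stable n (p n) \<le> ?U n"
    using p_le eventually_ge_at_top[of 2]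
  proof eventually_elim
    case (elim n)
    define L where "L = ln (real n)"
    have L: "L \<ge> 1" using elim by (simp add: L_def)
    have "p n \<le> L\<^sup>2 / real n * (1 - \<alpha> * (ln L / L))" using elim by (simp add: L_def)
    also have "\<dots> = L\<^sup>2 * (1 - \<alpha> * (ln L / L)) / real n" by simp
    also have "L\<^sup>2 * (1 - \<alpha> * (ln L / L)) = L\<^sup>2 - \<alpha> * L * ln L"
      using L by (simp add: power2_eq_square right_diff_distrib)
    finally have 1: "p n \<le> (L\<^sup>2 - \<alpha> * L * ln L) / real n" .
    have "0 \<le> \<alpha> * L * ln L" using \<alpha> L by (intro mult_nonneg_nonneg) auto
    then have 2: "p n \<le> L\<^sup>2 / real n"
      using 1 by (elim order.trans) (intro divide_right_mono, auto)
    have "p n * real n \<le> L\<^sup>2 - \<alpha> * L * ln L" using 1 elim by (simp add: pos_le_divide_eq)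
    \<comment> \<open>Completing the square, with \<open>\<alpha> = 2 * \<beta>\<close>.\<close>
    also have "\<dots> \<le> (L - \<beta> * ln L)\<^sup>2"
      using zero_le_power2[of "\<beta> * ln L"] unfolding power2_diff by (simp add: \<beta>_def)
    finally have 3: "p n * real n \<le> (\<kappa> n)\<^sup>2" by (simp add: \<kappa>_def L_def)
    show ?case
      using elim p_range[of n] 2 3 unfolding L_def
      by (intro expected_stable_le[OF _ refl]) (simp_all only: less_imp_le)
  qed
  have "0 \<le> expected_stable n (p n)" for n
    unfolding expected_stable_def by (rule integral_nonneg_AE) simp
  then have "\<forall>\<^sub>F n in sequentially. 0 \<le> expected_stable n (p n)" by simp
  then show ?thesis by (rule tendsto_sandwich[OF _ le tendsto_const lim])
qed

lemma expected_stable_at_top: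
  fixes p :: "nat \<Rightarrow> real"
  assumes p_range: "\<And>n. 0 < p n \<and> p n < 1"
    and p_ge: "\<forall>\<^sub>F n in sequentially. p n \<ge> (ln (real n))\<^sup>2 / real n"
  shows "filterlim (\<lambda>n. expected_stable n (p n)) at_top sequentially"
proof -
  let ?U = "\<lambda>n. ((real n)\<^sup>2 / (ln (real n) + 2) - (real n)\<^sup>2 / (ln (real n) + 3) - 1) *
     (1 / (2 * real n) * exp (- ((ln (real n) + 3) / 2 + (ln (real n) + 3)\<^sup>2 / real n)) *
       (1 - exp 3 / real n) ^ n)"
  \<comment> \<open>There are about \<open>n\<^sup>2 / (ln n)\<^sup>2\<close> ranks in the window,
    each contributing the order of \<open>n\<close> to the power \<open>- 3 / 2\<close>, so the
    bound grows like \<open>sqrt n / (ln n)\<^sup>2\<close>.\<close>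
  have lim: "filterlim ?U at_top sequentially" by real_asymp
  have "\<forall>\<^sub>F n in sequentially. 2 * (ln (real n) + 3) \<le> real n" by real_asymp
  moreover have "\<forall>\<^sub>F n in sequentially. exp 3 / real n \<le> 1" by real_asymp
  moreover have "\<forall>\<^sub>F n in sequentially. 1 \<le> ln (real n)" by real_asymp
  ultimately have "\<forall>\<^sub>F n in sequentially. ?U n \<le> expected_stable n (p n)"
    using p_ge eventually_ge_at_top[of 2]
  proof eventually_elim
    case (elim n)
    then show ?case
      using expected_stable_ge[of n "ln (real n)" "p n"] p_range[of n] by simp
  qed
  with lim show ?thesis by (rule filterlim_at_top_mono)
qed

theorem theorem1p1:
  fixes p :: "nat \<Rightarrow> real"
  assumes p_range: "\<And>n. 0 < p n \<and> p n < 1"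
  shows
    "((\<exists>\<alpha>::real. \<alpha> > 2 \<and>
        (\<forall>\<^sub>F n in sequentially.
           p n \<le> (ln (real n))\<^sup>2 / real n * (1 - \<alpha> * (ln (ln (real n)) / ln (real n)))))
      \<longrightarrow> (\<lambda>n. expected_stable n (p n)) \<longlonglongrightarrow> 0)
    \<and>
    ((\<forall>\<^sub>F n in sequentially. p n \<ge> (ln (real n))\<^sup>2 / real n)
      \<longrightarrow> filterlim (\<lambda>n. expected_stable n (p n)) at_top sequentially)"
  using expected_stable_tendsto_zero[of p] expected_stable_at_top[of p] p_range by blast

end
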